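(* For some sufficiently large $c\in\mathbb{N}$, the set $$A=\{x\in\{0,1\}^{\mathbb{N}}_c:\ \forall n,\ Km(x\restriction n)<n/2+c\}$$ is a Markov-semidecidable, non-empty, closed subset of $\{0,1\}^{\mathbb{N}}_c$ with empty interior in $\{0,1\}^{\mathbb{N}}_c$, and $A$ is not $\Sigma^0_2$, i.e. there is no $\Sigma^0_2$ subset $\mathcal{S}$ of $\{0,1\}^{\mathbb{N}}$ with $\mathcal{S}\cap\{0,1\}^{\mathbb{N}}_c=A$.
   Context: Cantor space $\{0,1\}^{\mathbb{N}}$ carries the product topology generated by the cylinders $[u]$ (sequences extending a finite binary string $u$), with the effective numbering of cylinders; $\{0,1\}^{\mathbb{N}}_c$ is the set of computable binary sequences, with the subspace topology. A Markov name of a computable sequence $x$ is an index of a program computing $x$. A set $A\subseteq\{0,1\}^{\mathbb{N}}_c$ is Markov-semidecidable if a Turing machine, given any Markov name of any computable $x$, halts iff $x\in A$. $x\restriction n$ denotes the first $n$ bits of $x$. The monotone complexity $Km(u)$ of a finite string $u$ is the length of a shortest program which, on a one-way output tape and possibly never halting, outputs a finite or infinite binary sequence extending $u$. $K(x)$ for a computable sequence $x$ is the length of a shortest program computing $x$, with the convention (satisfied for the chosen definitions) that $Km(x\restriction n)\leq K(x)$ for all $n$. A subset of $\{0,1\}^{\mathbb{N}}$ is effective open if it is a union of a c.e. family of cylinders, and $\Sigma^0_2$ if it is of the form $\bigcup_n(\mathcal{U}_n\setminus\mathcal{V}_n)$ with $\mathcal{U}_n,\mathcal{V}_n$ uniformly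 effective open. *)

theory Defs
  imports
    "HOL-Library.Nat_Bijection"
    "HOL-Library.Sublist"
    "HOL-Analysis.Function_Topology"
begin

text \<open>
  Programs for the partial recursive functions of one natural-number argument; several
  arguments are packed with \<^const>\<open>prod_encode\<close>.  Together with pairing, the constructors
  for composition, primitive recursion and unbounded minimisation give Kleene's
  partial recursive functions.
\<close>

datatype prog =
    Zero
  | Succ
  | Fst
  | Snd
  | Pair prog prog
  | Comp prog prog
  | Prec prog prog
  | Mu prog

text \<open>\<open>eval f n m\<close>: program \<open>f\<close> halts on input \<open>n\<close> with result \<open>m\<close>.\<close>

inductive eval :: "prog \<Rightarrow> nat \<Rightarrow> nat \<Rightarrow> bool" where
  eval_Zero: "eval Zero n 0"
| eval_Succ: "eval Succ n (Suc n)"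
| eval_Fst: "eval Fst (prod_encode (a, b)) a"
| eval_Snd: "eval Snd (prod_encode (a, b)) b"
| eval_Pair: "eval f n a \<Longrightarrow> eval g n b \<Longrightarrow> eval (Pair f g) n (prod_encode (a, b))"
| eval_Comp: "eval g n m \<Longrightarrow> eval f m k \<Longrightarrow> eval (Comp f g) n k"
| eval_Prec_0: "eval f a m \<Longrightarrow> eval (Prec f g) (prod_encode (a, 0)) m"
| eval_Prec_Suc:
    "eval (Prec f g) (prod_encode (a, n)) m \<Longrightarrow>
     eval g (prod_encode (a, prod_encode (n, m))) k \<Longrightarrow>
     eval (Prec f g) (prod_encode (a, Suc n)) k"
| eval_Mu:
    "eval f (prod_encode (a, n)) 0 \<Longrightarrow>
     (\<forall>k<n. \<exists>m. eval f (prod_encode (a, k)) (Suc m)) \<Longrightarrow>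
     eval (Mu f) a n"

definition halts :: "prog \<Rightarrow> nat \<Rightarrow> bool" where
  "halts f n \<longleftrightarrow> (\<exists>m. eval f n m)"

primrec index :: "prog \<Rightarrow> nat" where
  "index Zero = prod_encode (0, 0)"
| "index Succ = prod_encode (1, 0)"
| "index Fst = prod_encode (2, 0)"
| "index Snd = prod_encode (3, 0)"
| "index (Pair f g) = prod_encode (4, prod_encode (index f, index g))"
| "index (Comp f g) = prod_encode (5, prod_encode (index f, index g))"
| "index (Prec f g) = prod_encode (6, prod_encode (index f, index g))"
| "index (Mu f) = prod_encode (7, index f)"

definition ce :: "nat set \<Rightarrow> bool" where
  "ce W \<longleftrightarrow> (\<exists>f. W = {n. halts f n})"

definition string_index :: "bool list \<Rightarrow> nat" where
  "string_index u = list_encode (map of_bool u)"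


text \<open>
  Cantor space is the type \<^typ>\<open>nat \<Rightarrow> bool\<close>, whose library topology is the product of the
  discrete topologies.
\<close>

definition init_seg :: "(nat \<Rightarrow> bool) \<Rightarrow> nat \<Rightarrow> bool list" where
  "init_seg x n = map x [0..<n]"

definition cylinder :: "bool list \<Rightarrow> (nat \<Rightarrow> bool) set" where
  "cylinder u = {x. init_seg x (length u) = u}"

definition computes :: "prog \<Rightarrow> (nat \<Rightarrow> bool) \<Rightarrow> bool" where
  "computes f x \<longleftrightarrow> (\<forall>n. eval f n (of_bool (x n)))"

definition computable_seqs :: "(nat \<Rightarrow> bool) set" where
  "computable_seqs = {x. \<exists>f. computes f x}"

definition markov_name :: "nat \<Rightarrow> (nat \<Rightarrow> bool) \<Rightarrow> bool" where
  "markov_name e x \<longleftrightarrow> (\<exists>f. e = index f \<and> computes f x)"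

text \<open>The behaviour of the semideciding program on numbers that are not names is arbitrary.\<close>

definition markov_semidecidable :: "(nat \<Rightarrow> bool) set \<Rightarrow> bool" where
  "markov_semidecidable A \<longleftrightarrow>
     A \<subseteq> computable_seqs \<and>
     (\<exists>d. \<forall>e. \<forall>x\<in>computable_seqs. markov_name e x \<longrightarrow> (halts d e \<longleftrightarrow> x \<in> A))"

definition uniformly_effective_open :: "(nat \<Rightarrow> (nat \<Rightarrow> bool) set) \<Rightarrow> bool" where
  "uniformly_effective_open U \<longleftrightarrow>
     (\<exists>W. ce W \<and>
       (\<forall>n. U n = \<Union> {cylinder u | u. prod_encode (n, string_index u) \<in> W}))"

definition sigma02 :: "(nat \<Rightarrow> bool) set \<Rightarrow> bool" where
  "sigma02 S \<longleftrightarrow>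
     (\<exists>U V. uniformly_effective_open U \<and> uniformly_effective_open V \<and>
       S = (\<Union>n. U n - V n))"


text \<open>
  A monotone machine has a one-way read-only binary input tape and a one-way write-only
  binary output tape.  Between two tape operations it computes internally, possibly forever,
  and its next operation depends only on what it has read and written so far.  So
  every program \<open>M\<close> describes such a machine: on the (encoded) pair of the string read
  so far and the string written so far, the result 0 or 1 means writing that bit, 2 means
  reading the next input bit, and no (or any other) result means no further tape
  operation.  \<open>outputs M p v\<close>: there is a moment at which \<open>M\<close> has read exactly \<open>p\<close> and
  written exactly \<open>v\<close>.
\<close>

inductive outputs :: "prog \<Rightarrow> bool list \<Rightarrow> bool list \<Rightarrow> bool" for M where
  outputs_start: "outputs M [] []"
| outputs_write:
    "outputs M p v \<Longrightarrow>
     eval M (prod_encode (string_index p, string_index v)) (of_bool b) \<Longrightarrow>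
     outputs M p (v @ [b])"
| outputs_read:
    "outputs M p v \<Longrightarrow>
     eval M (prod_encode (string_index p, string_index v)) 2 \<Longrightarrow>
     outputs M (p @ [b]) v"

text \<open>
  The finite or infinite output on \<open>p\<close> extends \<open>u\<close> iff, at some moment, the finite string
  written so far does.
\<close>

definition output_extends :: "prog \<Rightarrow> bool list \<Rightarrow> bool list \<Rightarrow> bool" where
  "output_extends M p u \<longleftrightarrow> (\<exists>v. outputs M p v \<and> prefix u v)"

text \<open>
  The universal reference machine is any additively optimal one, for instance the
  machine that reads \<open>1\<^sup>e0\<close> and then simulates the machine with index \<open>e\<close>.
\<close>

definition optimal_monotone_machine :: "prog \<Rightarrow> bool" where
  "optimal_monotone_machine U \<longleftrightarrow>
     (\<forall>M. \<exists>d. \<forall>p u. output_extends M p u \<longrightarrow>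
       (\<exists>q. output_extends U q u \<and> length q \<le> length p + d))"

text \<open>For optimal \<open>U\<close> every string has a program, so the minimum exists.\<close>

definition Km :: "prog \<Rightarrow> bool list \<Rightarrow> nat" where
  "Km U u = (LEAST k. \<exists>p. output_extends U p u \<and> length p = k)"

end

theory Submission
  imports Defs
begin

text \<open>
  A program with index \<open>e\<close> for \<open>x\<close> bounds \<open>Km(x\<restriction>n)\<close> by \<open>e + d\<close> for all \<open>n\<close>, so that \<open>Km(x\<restriction>n) < n/2 + c\<close>
  has to be semidecided for \<open>n \<le> 2(e + d)\<close> only.  There are fewer than \<open>2\<^sup>k\<close> strings of a given
  length with \<open>Km < k\<close>, hence every cylinder contains a computable sequence outside \<open>A\<close>.  If \<open>A\<close>
  were the trace of a union of uniformly effective closed sets, their complements would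
  therefore be dense effective open sets.  An effective Baire category construction
  started at \<open>0\<^bsup>4m\<^esup>\<close> then yields a computable sequence in all of these complements with
  complexity at most \<open>m + d\<close>; for \<open>m = d\<close> it lies in \<open>A\<close>.
\<close>

section \<open>Computable functions on encoded types\<close>

text \<open>The overhead \<open>d\<close> belongs to the machine that realises the Baire
  construction, so it is unknown while the construction is being set up. Hence one construction is
  run for all \<open>m\<close> at once: coding \<open>m\<close> in unary costs \<open>m\<close> bits
  up to a constant, while the block of \<open>4 * m\<close> zeros leaves room for complexity
  \<open>2 * m\<close>, and \<open>m + d \<le> 2 * m\<close> as soon as \<open>m \<ge> d\<close>.

  A difference \<open>V n - W n\<close> of effective open sets need not be closed. It splits into
  the closed sets \<open>[u] - W n\<close>, where \<open>[u]\<close> runs through the enumerated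
  cylinders of \<open>V n\<close>; that \<open>u\<close> is never enumerated cannot be confirmed
  effectively. The requirements of the construction therefore carry a time bound, which makes this
  decidable.

  Evaluation and machine output are inductively defined. Both are semidecided by a search for finite
  derivations, which takes the place of a universal program.\<close>

lemma eval_deterministic: "eval f n m \<Longrightarrow> eval f n m' \<Longrightarrow> m = m'"
proof (induction arbitrary: m' rule: eval.induct)
  case (eval_Pair f n a g b)
  from eval_Pair.prems show ?case
    by cases (use eval_Pair.IH in auto)
next
  case (eval_Comp g n m f k)
  from eval_Comp.prems show ?case
    by cases (use eval_Comp.IH in blast)
next
  case (eval_Prec_0 f a m g)
  from eval_Prec_0.prems show ?case
    by cases (use eval_Prec_0.IH in auto)
next
  case (eval_Prec_Suc f g a n m k)
  from eval_Prec_Suc.prems show ?case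
    by cases (use eval_Prec_Suc.IH in auto)
next
  case (eval_Mu f a n)
  from eval_Mu.prems show ?case
  proof cases
    case eval_Mu': eval_Mu
    have "\<not> m' < n"
      using eval_Mu.IH eval_Mu'(1) by fastforce
    moreover have "\<not> n < m'"
      using eval_Mu.IH(1) eval_Mu'(2) by fastforce
    ultimately show ?thesis by simp
  qed
qed (auto elim: eval.cases)

section \<open>Injective codings and total computable functions\<close>

class encodable =
  fixes enc :: "'a \<Rightarrow> nat"
  assumes enc_inject: "enc x = enc y \<Longrightarrow> x = y"
begin

lemma enc_eq_iff [simp]: "enc x = enc y \<longleftrightarrow> x = y"
  using enc_inject by blast

end

instantiation nat :: encodable
begin
definition enc_nat :: "nat \<Rightarrow> nat" where [simp]: "enc_nat n = n"
instance by standard simp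
end

instantiation bool :: encodable
begin
definition enc_bool :: "bool \<Rightarrow> nat" where [simp]: "enc_bool b = of_bool b"
instance by standard (simp only: enc_bool_def of_bool_eq_iff)
end

instantiation prod :: (encodable, encodable) encodable
begin
definition enc_prod :: "'a \<times> 'b \<Rightarrow> nat" where
  "enc_prod z = prod_encode (enc (fst z), enc (snd z))"
instance by standard (auto simp: enc_prod_def prod_eq_iff)
end

instantiation list :: (encodable) encodable
begin
definition enc_list :: "'a list \<Rightarrow> nat" where
  "enc_list xs = list_encode (map enc xs)"
instance proof
  fix xs ys :: "'a list"
  assume "enc xs = enc ys"
  hence "map enc xs = map enc ys"
    using inj_list_encode[of UNIV] by (simp add: enc_list_def inj_eq)
  moreover have "inj (enc :: 'a \<Rightarrow> nat)"
    by (simp add: inj_def)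
  ultimately show "xs = ys"
    by (simp add: inj_map_eq_map)
qed
end

lemma enc_Pair [simp]: "enc (x, y) = prod_encode (enc x, enc y)"
  by (simp add: enc_prod_def)

lemma enc_Nil [simp]: "enc [] = 0"
  by (simp add: enc_list_def)

lemma enc_Cons [simp]: "enc (x # xs) = Suc (prod_encode (enc x, enc xs))"
  by (simp add: enc_list_def)

lemma enc_nat_prod: "enc z = prod_encode z" for z :: "nat \<times> nat"
  by (cases z) simp

lemma enc_nat_list: "enc l = list_encode l" for l :: "nat list"
  by (simp add: enc_list_def map_idI)

lemma enc_bool_list: "enc u = string_index u" for u :: "bool list"
  by (simp add: enc_list_def string_index_def cong: map_cong)

lemma length_le_enc: "length xs \<le> enc xs"
proof (induction xs)
  case (Cons x xs)
  have "enc xs \<le> prod_encode (enc x, enc xs)"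
    by (rule le_prod_encode_2)
  with Cons show ?case by simp
qed simp

text \<open>Only the codes of arguments constrain the program, so \<open>enc\<close> has to be
  injective but not surjective.\<close>

definition computable :: "('a::encodable \<Rightarrow> 'b::encodable) \<Rightarrow> bool" where
  "computable f \<longleftrightarrow> (\<exists>p. \<forall>x. eval p (enc x) (enc (f x)))"

lemma computableI: "(\<And>x. eval p (enc x) (enc (f x))) \<Longrightarrow> computable f"
  unfolding computable_def by blast

named_theorems comp_intros

lemma eval_identity: "eval (Pair Fst Snd) n n"
  by (metis eval_Fst eval_Pair eval_Snd prod_decode_inverse surj_pair)

text \<open>Equal codes mean that the same program works. Pairing, decoding and \<open>enc\<close>
  itself become computable in this way, because they leave the code unchanged.\<close>

lemma computable_reencode:
  assumes "computable f" "\<And>x. enc (g x) = enc (f x)"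
  shows "computable g"
  using assms by (auto simp: computable_def)

lemma computable_id [comp_intros]: "computable (\<lambda>x. x)"
  by (rule computableI) (rule eval_identity)

primrec const_prog :: "nat \<Rightarrow> prog" where
  "const_prog 0 = Zero"
| "const_prog (Suc n) = Comp Succ (const_prog n)"

lemma eval_const_prog: "eval (const_prog c) n c"
  by (induction c) (auto intro: eval.intros)

lemma computable_const [comp_intros]: "computable (\<lambda>x. c)"
  by (rule computableI) (rule eval_const_prog)

lemma computable_comp:
  assumes "computable f" "computable g"
  shows "computable (\<lambda>x. f (g x))"
proof -
  from assms(1) obtain p where p: "\<And>x. eval p (enc x) (enc (f x))" unfolding computable_def by blast
  from assms(2) obtain q where q: "\<And>x. eval q (enc x) (enc (g x))" unfolding computable_def by blast
  show ?thesis
    by (rule computableI[of "Comp p q"]) (auto intro: eval_Comp p q)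
qed

lemma computable_Pair [comp_intros]:
  assumes "computable f" "computable g"
  shows "computable (\<lambda>x. (f x, g x))"
proof -
  from assms(1) obtain p where p: "\<And>x. eval p (enc x) (enc (f x))" unfolding computable_def by blast
  from assms(2) obtain q where q: "\<And>x. eval q (enc x) (enc (g x))" unfolding computable_def by blast
  show ?thesis
    by (rule computableI[of "Pair p q"]) (auto intro: eval_Pair p q)
qed

lemma computable_fst [comp_intros]:
  assumes "computable f" shows "computable (\<lambda>x. fst (f x))"
proof (rule computable_comp[OF _ assms])
  show "computable (fst :: 'b \<times> 'c \<Rightarrow> 'b)"
    by (rule computableI[of Fst]) (auto simp: enc_prod_def intro: eval_Fst)
qed

lemma computable_snd [comp_intros]:
  assumes "computable f" shows "computable (\<lambda>x. snd (f x))"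
proof (rule computable_comp[OF _ assms])
  show "computable (snd :: 'b \<times> 'c \<Rightarrow> 'c)"
    by (rule computableI[of Snd]) (auto simp: enc_prod_def intro: eval_Snd)
qed

lemma computable_Suc [comp_intros]:
  assumes "computable f" shows "computable (\<lambda>x. Suc (f x))"
  by (rule computable_comp[OF computableI[of Succ] assms]) (auto intro: eval_Succ)

lemma computable_enc [comp_intros]:
  assumes "computable f" shows "computable (\<lambda>x. enc (f x))"
  by (rule computable_reencode[OF assms]) simp

lemma computable_prod_decode [comp_intros]:
  assumes "computable f" shows "computable (\<lambda>x. prod_decode (f x))"
  by (rule computable_reencode[OF assms]) (simp add: enc_nat_prod)

lemma computable_prod_encode [comp_intros]:
  assumes "computable f" shows "computable (\<lambda>x. prod_encode (f x))"
  by (rule computable_reencode[OF assms]) (simp add: enc_nat_prod)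

lemma computable_list_decode [comp_intros]:
  assumes "computable f" shows "computable (\<lambda>x. list_decode (f x))"
  by (rule computable_reencode[OF assms]) (simp add: enc_nat_list)

lemma computable_of_bool [comp_intros]:
  assumes "computable f" shows "computable (\<lambda>x. of_bool (f x) :: nat)"
  by (rule computable_reencode[OF assms]) simp

text \<open>\<open>Prec\<close> carries its parameter through the recursion, so the step may depend
  on \<open>x\<close>. As in every rule here that binds variables, the bound term is given as a
  function of one tuple, which brings it back under the predicate \<open>computable\<close>.\<close>

lemma computable_rec_nat [comp_intros]:
  assumes "computable f" "computable (\<lambda>z. g (fst z) (fst (snd z)) (snd (snd z)))" "computable k"
  shows "computable (\<lambda>x. rec_nat (f x) (\<lambda>n r. g x n r) (k x))"
proof -
  from assms(1) obtain p where p: "\<And>x. eval p (enc x) (enc (f x))" unfolding computable_def by blast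
  from assms(2) obtain q where
    "\<And>z. eval q (enc z) (enc (g (fst z) (fst (snd z)) (snd (snd z))))" unfolding computable_def by blast
  from this[of "(x, n, r)" for x n r]
  have q: "eval q (prod_encode (enc x, prod_encode (n, enc r))) (enc (g x n r))" for x n r
    by simp
  from assms(3) obtain s where s: "\<And>x. eval s (enc x) (enc (k x))" unfolding computable_def by blast
  have rec: "eval (Prec p q) (prod_encode (enc x, n)) (enc (rec_nat (f x) (g x) n))" for x n
    by (induction n) (auto intro: eval.intros p q)
  show ?thesis
    by (rule computableI[of "Comp (Prec p q) (Pair (Pair Fst Snd) s)"])
      (rule eval_Comp, rule eval_Pair, rule eval_identity, rule s, simp add: rec)
qed

text \<open>Branching as a primitive recursion of length \<open>c\<close>: length 0 returns the base
  \<open>q\<close>; length 1 runs the step, which drops the counter and the previous value and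
  evaluates \<open>p\<close> on the original input.\<close>

definition if_prog :: "prog \<Rightarrow> prog \<Rightarrow> prog \<Rightarrow> prog" where
  "if_prog c p q = Comp (Prec q (Comp p Fst)) (Pair (Pair Fst Snd) c)"

lemma eval_if_prog_0:
  "eval c n 0 \<Longrightarrow> eval q n m \<Longrightarrow> eval (if_prog c p q) n m"
  unfolding if_prog_def by (blast intro: eval.intros eval_identity)

text \<open>The else branch is the base of a primitive recursion, so it has to converge in any case.\<close>

lemma eval_if_prog_1:
  "eval c n 1 \<Longrightarrow> eval q n m' \<Longrightarrow> eval p n m \<Longrightarrow> eval (if_prog c p q) n m"
  unfolding if_prog_def
  by (rule eval_Comp, rule eval_Pair, rule eval_identity, assumption, unfold One_nat_def)
    (blast intro: eval.intros)

lemma computable_If [comp_intros]: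
  assumes "computable b" "computable f" "computable g"
  shows "computable (\<lambda>x. if b x then f x else g x)"
proof -
  from assms(1) obtain r where r: "\<And>x. eval r (enc x) (enc (b x))" unfolding computable_def by blast
  from assms(2) obtain p where p: "\<And>x. eval p (enc x) (enc (f x))" unfolding computable_def by blast
  from assms(3) obtain q where q: "\<And>x. eval q (enc x) (enc (g x))" unfolding computable_def by blast
  show ?thesis
  proof (rule computableI[of "if_prog r p q"])
    fix x
    show "eval (if_prog r p q) (enc x) (enc (if b x then f x else g x))"
      using r[of x] by (auto intro: eval_if_prog_0 eval_if_prog_1 p q)
  qed
qed

section \<open>Connectives, arithmetic and bounded quantifiers\<close>

lemma computable_conj [comp_intros]:
  assumes "computable P" "computable Q" shows "computable (\<lambda>x. P x \<and> Q x)"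
  by (rule computable_reencode[OF computable_If[OF assms computable_const[of False]]]) simp

lemma computable_disj [comp_intros]:
  assumes "computable P" "computable Q" shows "computable (\<lambda>x. P x \<or> Q x)"
  by (rule computable_reencode[OF computable_If[OF assms(1) computable_const[of True] assms(2)]]) simp

lemma computable_not [comp_intros]:
  assumes "computable P" shows "computable (\<lambda>x. \<not> P x)"
  by (rule computable_reencode[OF computable_If[OF assms computable_const[of False] computable_const[of True]]])
    simp

lemma computable_case_nat [comp_intros]:
  assumes "computable f" "computable (\<lambda>z. g (fst z) (snd z))" "computable k"
  shows "computable (\<lambda>x. case k x of 0 \<Rightarrow> f x | Suc n \<Rightarrow> g x n)"
proof -
  have "computable (\<lambda>z :: 'a \<times> nat \<times> 'b. g (fst z) (fst (snd z)))"
    using computable_comp[OF assms(2), of "\<lambda>z :: 'a \<times> nat \<times> 'b. (fst z, fst (snd z))"]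
    by (simp add: comp_intros)
  hence "computable (\<lambda>x. rec_nat (f x) (\<lambda>n r. g x n) (k x))"
    by (intro computable_rec_nat assms) simp
  moreover have "rec_nat a (\<lambda>n r. h n) n = (case n of 0 \<Rightarrow> a | Suc n \<Rightarrow> h n)" for a :: 'b and h n
    by (cases n) auto
  ultimately show ?thesis by simp
qed

lemma computable_minus [comp_intros]:
  fixes f g :: "'a::encodable \<Rightarrow> nat"
  assumes "computable f" "computable g" shows "computable (\<lambda>x. f x - g x)"
proof -
  have eq: "m - n = rec_nat m (\<lambda>_ r. case r of 0 \<Rightarrow> 0 | Suc k \<Rightarrow> k) n" for m n :: nat
    by (induction n) (auto split: nat.splits)
  show ?thesis unfolding eq by (intro comp_intros assms)
qed

lemma computable_add [comp_intros]:
  fixes f g :: "'a::encodable \<Rightarrow> nat"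
  assumes "computable f" "computable g" shows "computable (\<lambda>x. f x + g x)"
proof -
  have eq: "m + n = rec_nat m (\<lambda>_ r. Suc r) n" for m n :: nat
    by (induction n) auto
  show ?thesis unfolding eq by (intro comp_intros assms)
qed

lemma computable_mult [comp_intros]:
  fixes f g :: "'a::encodable \<Rightarrow> nat"
  assumes "computable f" "computable g" shows "computable (\<lambda>x. f x * g x)"
proof -
  have eq: "m * n = rec_nat 0 (\<lambda>_ r. r + m) n" for m n :: nat
    by (induction n) auto
  show ?thesis unfolding eq
    by (intro comp_intros assms computable_comp[OF assms(1)])
qed

lemma computable_le [comp_intros]:
  fixes f g :: "'a::encodable \<Rightarrow> nat"
  assumes "computable f" "computable g" shows "computable (\<lambda>x. f x \<le> g x)"
proof -
  have eq: "m \<le> n \<longleftrightarrow> (case m - n of 0 \<Rightarrow> True | Suc _ \<Rightarrow> False)" for m n :: nat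
    by (auto split: nat.splits)
  show ?thesis unfolding eq by (intro comp_intros assms)
qed

lemma computable_less [comp_intros]:
  fixes f g :: "'a::encodable \<Rightarrow> nat"
  assumes "computable f" "computable g" shows "computable (\<lambda>x. f x < g x)"
  unfolding not_le[symmetric] by (intro comp_intros assms)

lemma computable_eq [comp_intros]:
  assumes "computable f" "computable g" shows "computable (\<lambda>x. f x = g x)"
proof -
  have eq: "f x = g x \<longleftrightarrow> enc (f x) \<le> enc (g x) \<and> enc (g x) \<le> enc (f x)" for x
    by (metis enc_eq_iff order_antisym order_refl)
  show ?thesis unfolding eq by (intro comp_intros assms)
qed

lemma computable_ex_less [comp_intros]:
  fixes k :: "'a::encodable \<Rightarrow> nat"
  assumes "computable (\<lambda>z. P (fst z) (snd z))" "computable k"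
  shows "computable (\<lambda>x. \<exists>n<k x. P x n)"
proof -
  have eq: "(\<exists>n<k. Q n) \<longleftrightarrow> rec_nat False (\<lambda>n r. r \<or> Q n) k" for k Q
    by (induction k) (auto simp: less_Suc_eq)
  have "computable (\<lambda>z :: 'a \<times> nat \<times> bool. P (fst z) (fst (snd z)))"
    using computable_comp[OF assms(1), of "\<lambda>z :: 'a \<times> nat \<times> bool. (fst z, fst (snd z))"]
    by (simp add: comp_intros)
  thus ?thesis unfolding eq by (intro comp_intros assms)
qed

lemma computable_all_less [comp_intros]:
  fixes k :: "'a::encodable \<Rightarrow> nat"
  assumes "computable (\<lambda>z. P (fst z) (snd z))" "computable k"
  shows "computable (\<lambda>x. \<forall>n<k x. P x n)"
proof -
  have eq: "(\<forall>n<k x. P x n) \<longleftrightarrow> \<not> (\<exists>n<k x. \<not> P x n)" for x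
    by auto
  show ?thesis unfolding eq by (intro comp_intros assms)
qed

lemma computable_finite_set:
  assumes "finite S" shows "computable (\<lambda>x. x \<in> S)"
  using assms
proof induction
  case (insert a S)
  thus ?case unfolding insert_iff by (intro comp_intros)
qed (simp add: comp_intros)

section \<open>Lists\<close>

lemma computable_Cons [comp_intros]:
  assumes "computable f" "computable g" shows "computable (\<lambda>x. f x # g x)"
  by (rule computable_reencode[where f = "\<lambda>x. Suc (enc (f x, g x))"])
    (intro comp_intros assms, simp)

text \<open>The predecessor of the code of \<open>y # ys\<close> is the code of
  \<open>(y, ys)\<close>. For the empty list it may code nothing, so the distinction is made on the
  level of programs: \<open>if_prog\<close> does not run its first branch when the condition is
  0.\<close>

lemma computable_case_list [comp_intros]:
  assumes "computable f" "computable (\<lambda>z. g (fst z) (fst (snd z)) (snd (snd z)))" "computable l"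
  shows "computable (\<lambda>x. case l x of [] \<Rightarrow> f x | y # ys \<Rightarrow> g x y ys)"
proof -
  from assms(1) obtain p where p: "\<And>x. eval p (enc x) (enc (f x))" unfolding computable_def by blast
  from assms(2) obtain q where
    "\<And>z. eval q (enc z) (enc (g (fst z) (fst (snd z)) (snd (snd z))))" unfolding computable_def by blast
  from this[of "(x, y, ys)" for x y ys]
  have q: "eval q (prod_encode (enc x, prod_encode (enc y, enc ys))) (enc (g x y ys))" for x y ys
    by simp
  have "computable (\<lambda>x. \<not> enc (l x) = 0)"
    by (intro comp_intros assms)
  then obtain r where r: "\<And>x. eval r (enc x) (enc (\<not> enc (l x) = 0))" unfolding computable_def by blast
  have "computable (\<lambda>x. enc (l x) - 1)"
    by (intro comp_intros assms)
  then obtain s where s: "\<And>x. eval s (enc x) (enc (enc (l x) - 1))" unfolding computable_def by blast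
  show ?thesis
  proof (rule computableI[of "if_prog r (Comp q (Pair (Pair Fst Snd) s)) p"])
    fix x
    show "eval (if_prog r (Comp q (Pair (Pair Fst Snd) s)) p) (enc x)
            (enc (case l x of [] \<Rightarrow> f x | y # ys \<Rightarrow> g x y ys))"
    proof (cases "l x")
      case Nil
      with r[of x] show ?thesis by (auto intro: eval_if_prog_0 p)
    next
      case (Cons y ys)
      have "eval (Comp q (Pair (Pair Fst Snd) s)) (enc x) (enc (g x y ys))"
        using s[of x] Cons by (auto intro!: eval_Comp eval_Pair eval_identity q)
      with r[of x] Cons show ?thesis by (auto intro: eval_if_prog_1 p)
    qed
  qed
qed

text \<open>Once the list is used up the state no longer changes, so any bound \<open>n\<close> on
  the length will do. The code of the list is such a bound, and it is available before
  \<open>length\<close> is known to be computable.\<close>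

lemma rec_nat_eq_fold:
  assumes "length l \<le> n"
  shows "snd (rec_nat (l, s) (\<lambda>_ r. case fst r of [] \<Rightarrow> r | y # ys \<Rightarrow> (ys, g y (snd r))) n)
    = fold g l s"
proof -
  let ?step = "\<lambda>r. case fst r of [] \<Rightarrow> r | y # ys \<Rightarrow> (ys, g y (snd r))"
  \<comment> \<open>Induction on the list peels off the first application of the step,
    \<open>rec_nat\<close> the last one; the step commutes with its iterates.\<close>
  have shift: "rec_nat (?step r) (\<lambda>_. ?step) n = ?step (rec_nat r (\<lambda>_. ?step) n)" for r n
    by (induction n) (simp_all only: nat.rec)
  have empty: "rec_nat ([], s) (\<lambda>_. ?step) n = ([], s)" for n s
    by (induction n) auto
  show ?thesis using assms
  proof (induction l arbitrary: n s)
    case Nil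
    show ?case by (simp add: empty)
  next
    case (Cons y ys)
    then obtain m where m: "n = Suc m" "length ys \<le> m" by (cases n) auto
    show ?case
      using Cons.IH[OF m(2), of "g y s"] shift[of "(y # ys, s)" m] m(1) by simp
  qed
qed

lemma computable_fold [comp_intros]:
  assumes "computable (\<lambda>z. g (fst z) (fst (snd z)) (snd (snd z)))" "computable l" "computable s"
  shows "computable (\<lambda>x. fold (\<lambda>y r. g x y r) (l x) (s x))"
proof -
  have eq: "fold (g x) (l x) (s x) = snd (rec_nat (l x, s x)
      (\<lambda>_ r. case fst r of [] \<Rightarrow> r | y # ys \<Rightarrow> (ys, g x y (snd r))) (enc (l x)))" for x
    by (rule rec_nat_eq_fold[symmetric]) (rule length_le_enc)
  have g: "computable (\<lambda>z. g (a z) (b z) (c z))"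
    if "computable a" "computable b" "computable c" for a b c
    using computable_comp[OF assms(1), of "\<lambda>z. (a z, b z, c z)"] that by (simp add: comp_intros)
  show ?thesis unfolding eq by (intro comp_intros assms g)
qed

lemma computable_rev [comp_intros]:
  assumes "computable l" shows "computable (\<lambda>x. rev (l x))"
proof -
  have eq: "rev l = fold (\<lambda>y r. y # r) l []" for l :: "'b list"
    by (simp add: fold_Cons_rev)
  show ?thesis unfolding eq by (intro comp_intros assms)
qed

lemma computable_append [comp_intros]:
  assumes "computable k" "computable l" shows "computable (\<lambda>x. k x @ l x)"
proof -
  have eq: "k @ l = fold (\<lambda>y r. y # r) (rev k) l" for k l :: "'b list"
    by (simp add: fold_Cons_rev)
  show ?thesis unfolding eq by (intro comp_intros assms)
qed

lemma computable_map [comp_intros]: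
  assumes "computable (\<lambda>z. g (fst z) (snd z))" "computable l"
  shows "computable (\<lambda>x. map (\<lambda>y. g x y) (l x))"
proof -
  have "fold (\<lambda>y r. h y # r) l s = rev (map h l) @ s" for h :: "'b \<Rightarrow> 'c" and l s
    by (induction l arbitrary: s) auto
  hence eq: "map h l = rev (fold (\<lambda>y r. h y # r) l [])" for h :: "'b \<Rightarrow> 'c" and l
    by simp
  have g: "computable (\<lambda>z. g (a z) (b z))" if "computable a" "computable b" for a b
    using computable_comp[OF assms(1), of "\<lambda>z. (a z, b z)"] that by (simp add: comp_intros)
  show ?thesis unfolding eq by (intro comp_intros assms g)
qed

lemma computable_length [comp_intros]:
  assumes "computable l" shows "computable (\<lambda>x. length (l x))"
proof -
  have "fold (\<lambda>y r. Suc r) l s = length l + s" for l :: "'b list" and s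
    by (induction l arbitrary: s) auto
  hence eq: "length l = fold (\<lambda>y r. Suc r) l 0" for l :: "'b list"
    by simp
  show ?thesis unfolding eq by (intro comp_intros assms)
qed

lemma computable_member [comp_intros]:
  assumes "computable f" "computable l" shows "computable (\<lambda>x. f x \<in> set (l x))"
proof -
  have "fold (\<lambda>y r. r \<or> y = a) l s \<longleftrightarrow> a \<in> set l \<or> s" for a :: 'b and l s
    by (induction l arbitrary: s) auto
  hence eq: "a \<in> set l \<longleftrightarrow> fold (\<lambda>y r. r \<or> y = a) l False" for a :: 'b and l
    by simp
  show ?thesis unfolding eq by (intro comp_intros assms computable_comp[OF assms(1)])
qed

lemma computable_drop [comp_intros]:
  assumes "computable n" "computable l" shows "computable (\<lambda>x. drop (n x) (l x))"
proof -
  have eq: "drop n l = rec_nat l (\<lambda>_ r. case r of [] \<Rightarrow> [] | y # ys \<Rightarrow> ys) n" for n and l :: "'b list"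
    by (induction n) (auto simp: drop_Suc simp flip: tl_drop split: list.splits)
  show ?thesis unfolding eq by (intro comp_intros assms)
qed

lemma computable_replicate [comp_intros]:
  assumes "computable n" "computable a" shows "computable (\<lambda>x. replicate (n x) (a x))"
proof -
  have eq: "replicate n a = rec_nat [] (\<lambda>_ r. a # r) n" for n and a :: 'b
    by (induction n) auto
  show ?thesis unfolding eq by (intro comp_intros assms computable_comp[OF assms(2)])
qed

section \<open>Semidecidable predicates\<close>

text \<open>A computable surjection from the natural numbers turns an existential quantifier over
  the type into a search over numbers.\<close>

class enumerable = encodable +
  assumes ex_enumeration: "\<exists>d :: nat \<Rightarrow> 'a. surj d \<and> (\<exists>p. \<forall>n. eval p n (enc (d n)))"

lemma ex_computable_surj: "\<exists>d :: nat \<Rightarrow> 'a::enumerable. computable d \<and> surj d"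
  using ex_enumeration by (auto simp: computable_def)

lemma enumerableI:
  assumes "computable (d :: nat \<Rightarrow> 'a::encodable)" "surj d"
  shows "\<exists>d :: nat \<Rightarrow> 'a. surj d \<and> (\<exists>p. \<forall>n. eval p n (enc (d n)))"
  using assms by (auto simp: computable_def)

instance nat :: enumerable
  by standard (rule enumerableI[of "\<lambda>n. n"], intro comp_intros, simp)

instance bool :: enumerable
proof
  show "\<exists>d :: nat \<Rightarrow> bool. surj d \<and> (\<exists>p. \<forall>n. eval p n (enc (d n)))"
  proof (rule enumerableI[of "\<lambda>n. n = 0"])
    show "surj (\<lambda>n :: nat. n = 0)"
      by (rule surjI[where f = "\<lambda>b. if b then 0 else 1"]) simp
  qed (intro comp_intros)
qed

instance prod :: (enumerable, enumerable) enumerable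
proof
  obtain d where d: "computable d" "surj (d :: nat \<Rightarrow> 'a)" using ex_computable_surj by blast
  obtain e where e: "computable e" "surj (e :: nat \<Rightarrow> 'b)" using ex_computable_surj by blast
  show "\<exists>d :: nat \<Rightarrow> 'a \<times> 'b. surj d \<and> (\<exists>p. \<forall>n. eval p n (enc (d n)))"
  proof (rule enumerableI[of "\<lambda>n. (d (fst (prod_decode n)), e (snd (prod_decode n)))"])
    show "surj (\<lambda>n. (d (fst (prod_decode n)), e (snd (prod_decode n))))"
      by (rule surjI[where f = "\<lambda>z. prod_encode (inv d (fst z), inv e (snd z))"])
        (simp add: surj_f_inv_f d e)
  qed (intro comp_intros computable_comp[OF d(1)] computable_comp[OF e(1)])
qed

instance list :: (enumerable) enumerable
proof
  obtain d where d: "computable d" "surj (d :: nat \<Rightarrow> 'a)" using ex_computable_surj by blast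
  show "\<exists>d :: nat \<Rightarrow> 'a list. surj d \<and> (\<exists>p. \<forall>n. eval p n (enc (d n)))"
  proof (rule enumerableI[of "\<lambda>n. map (\<lambda>k. d k) (list_decode n)"])
    show "surj (\<lambda>n. map (\<lambda>k. d k) (list_decode n))"
      by (rule surjI[where f = "\<lambda>l. list_encode (map (inv d) l)"])
        (simp add: surj_f_inv_f d o_def)
  qed (intro comp_intros computable_comp[OF d(1)])
qed

text \<open>The Sigma_1 normal form, with \<open>t\<close> as witness or running time. Closure
  properties are immediate in this form; \<open>semidecidable_halts\<close> leads back to halting
  programs.\<close>

definition semidecidable :: "('a::encodable \<Rightarrow> bool) \<Rightarrow> bool" where
  "semidecidable P \<longleftrightarrow> (\<exists>R. computable R \<and> (\<forall>x. P x \<longleftrightarrow> (\<exists>t::nat. R (x, t))))"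

lemma semidecidable_computable:
  assumes "computable P" shows "semidecidable P"
  unfolding semidecidable_def
  by (intro exI[of _ "\<lambda>z. P (fst z)"] conjI computable_comp[OF assms] comp_intros) auto

lemma semidecidable_comp:
  assumes "semidecidable P" "computable f" shows "semidecidable (\<lambda>x. P (f x))"
proof -
  from assms(1) obtain R where R: "computable R" "\<And>x. P x \<longleftrightarrow> (\<exists>t::nat. R (x, t))"
    unfolding semidecidable_def by blast
  have "computable (\<lambda>z :: 'b \<times> nat. R (f (fst z), snd z))"
    by (intro comp_intros computable_comp[OF R(1)] computable_comp[OF assms(2)])
  with R(2) show ?thesis unfolding semidecidable_def by fastforce
qed

lemma semidecidable_ex:
  assumes "semidecidable (\<lambda>z. P (fst z) (snd z))"
  shows "semidecidable (\<lambda>x. \<exists>y :: 'b::enumerable. P x y)"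
proof -
  from assms obtain R where R: "computable R" "\<And>z. P (fst z) (snd z) \<longleftrightarrow> (\<exists>t::nat. R (z, t))"
    unfolding semidecidable_def by blast
  obtain d where d: "computable d" "surj (d :: nat \<Rightarrow> 'b)" using ex_computable_surj by blast
  let ?R = "\<lambda>z. R ((fst z, d (fst (prod_decode (snd z)))), snd (prod_decode (snd z)))"
  have "(\<exists>y. P x y) \<longleftrightarrow> (\<exists>t. ?R (x, t))" for x
  proof
    assume "\<exists>y. P x y"
    then obtain y t where "R ((x, y), t)" using R(2)[of "(x, _)"] by auto
    moreover obtain k where "y = d k" using d(2) by blast
    ultimately have "?R (x, prod_encode (k, t))" by simp
    thus "\<exists>t. ?R (x, t)" by blast
  next
    assume "\<exists>t. ?R (x, t)"
    thus "\<exists>y. P x y" using R(2)[of "(x, _)"] by auto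
  qed
  moreover have "computable ?R"
    by (intro comp_intros computable_comp[OF R(1)] computable_comp[OF d(1)])
  ultimately show ?thesis unfolding semidecidable_def by blast
qed

lemma semidecidable_conj:
  assumes "semidecidable P" "semidecidable Q"
  shows "semidecidable (\<lambda>x. P x \<and> Q x)"
proof -
  from assms obtain R S where R: "computable R" "\<And>x. P x \<longleftrightarrow> (\<exists>t::nat. R (x, t))"
    and S: "computable S" "\<And>x. Q x \<longleftrightarrow> (\<exists>t::nat. S (x, t))"
    unfolding semidecidable_def by blast
  have eq: "P x \<and> Q x \<longleftrightarrow> (\<exists>s t. R (x, s) \<and> S (x, t))" for x
    using R(2) S(2) by blast
  show ?thesis unfolding eq
    by (intro semidecidable_ex; intro semidecidable_computable comp_intros
        computable_comp[OF R(1)] computable_comp[OF S(1)])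
qed

lemma semidecidable_disj:
  assumes "semidecidable P" "semidecidable Q"
  shows "semidecidable (\<lambda>x. P x \<or> Q x)"
proof -
  from assms obtain R S where R: "computable R" "\<And>x. P x \<longleftrightarrow> (\<exists>t::nat. R (x, t))"
    and S: "computable S" "\<And>x. Q x \<longleftrightarrow> (\<exists>t::nat. S (x, t))"
    unfolding semidecidable_def by blast
  have eq: "P x \<or> Q x \<longleftrightarrow> (\<exists>t. R (x, t) \<or> S (x, t))" for x
    using R(2) S(2) by blast
  show ?thesis unfolding eq
    by (intro semidecidable_ex; intro semidecidable_computable comp_intros
        computable_comp[OF R(1)] computable_comp[OF S(1)])
qed

text \<open>Sigma_1 collection: finitely many witnesses have a common bound \<open>b\<close>, so the
  unbounded quantifier moves to the front and leaves a decidable matrix.\<close>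

lemma semidecidable_all_less:
  fixes k :: "'a::encodable \<Rightarrow> nat"
  assumes "semidecidable (\<lambda>z. P (fst z) (snd z))" "computable k"
  shows "semidecidable (\<lambda>x. \<forall>n<k x. P x n)"
proof -
  from assms obtain R where R: "computable R" "\<And>z. P (fst z) (snd z) \<longleftrightarrow> (\<exists>t::nat. R (z, t))"
    unfolding semidecidable_def by blast
  have eq: "(\<forall>n<k x. P x n) \<longleftrightarrow> (\<exists>b. \<forall>n<k x. \<exists>t<b. R ((x, n), t))" for x
  proof
    assume "\<forall>n<k x. P x n"
    hence "\<forall>n<k x. \<exists>t. R ((x, n), t)" using R(2)[of "(x, _)"] by auto
    then obtain t where t: "\<forall>n<k x. R ((x, n), t n)" by metis
    have "\<forall>n<k x. \<exists>s<Suc (\<Sum>n<k x. t n). R ((x, n), s)"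
    proof (intro allI impI)
      fix n assume n: "n < k x"
      have "t n \<le> (\<Sum>n<k x. t n)"
        by (rule member_le_sum) (use n in auto)
      with t n show "\<exists>s<Suc (\<Sum>n<k x. t n). R ((x, n), s)"
        by (auto simp: less_Suc_eq_le)
    qed
    thus "\<exists>b. \<forall>n<k x. \<exists>t<b. R ((x, n), t)" by blast
  next
    assume "\<exists>b. \<forall>n<k x. \<exists>t<b. R ((x, n), t)"
    thus "\<forall>n<k x. P x n" using R(2)[of "(x, _)"] by auto
  qed
  show ?thesis unfolding eq
    by (intro semidecidable_ex; intro semidecidable_computable comp_intros
        computable_comp[OF R(1)] computable_comp[OF assms(2)])
qed

lemmas sd_intros = semidecidable_ex semidecidable_conj semidecidable_disj semidecidable_all_less

section \<open>Unbounded search and uniformization\<close>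

lemma least_search_prog:
  assumes "computable (R :: 'a::encodable \<times> nat \<Rightarrow> bool)"
  obtains p where "\<And>x n. eval p (enc x) n \<longleftrightarrow> R (x, n) \<and> (\<forall>k<n. \<not> R (x, k))"
proof -
  \<comment> \<open>\<open>Mu\<close> searches for the value 0, hence the negation.\<close>
  have "computable (\<lambda>z. \<not> R z)"
    by (intro comp_intros assms)
  then obtain q where "\<And>z. eval q (enc z) (enc (\<not> R z))" unfolding computable_def by blast
  hence q: "eval q (prod_encode (enc x, n)) (of_bool (\<not> R (x, n)))" for x n
    using enc_Pair[of x n] by (metis enc_bool_def enc_nat_def)
  have q_iff: "eval q (prod_encode (enc x, n)) m \<longleftrightarrow> m = of_bool (\<not> R (x, n))" for x n m
    using q eval_deterministic by blast
  have Mu_iff: "eval (Mu q) (enc x) n \<longleftrightarrow> eval q (prod_encode (enc x, n)) 0 \<and>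
      (\<forall>k<n. \<exists>m. eval q (prod_encode (enc x, k)) (Suc m))" for x n
    by (auto elim: eval.cases intro: eval_Mu)
  have "eval (Mu q) (enc x) n \<longleftrightarrow> R (x, n) \<and> (\<forall>k<n. \<not> R (x, k))" for x n
    unfolding Mu_iff q_iff by (auto simp: of_bool_def)
  with that show thesis by blast
qed

text \<open>A single search over coded pairs of a candidate and a witness for it, followed by the
  projection to the candidate. The result \<open>y'\<close> may differ from \<open>y\<close> unless
  \<open>G x\<close> is single-valued.\<close>

lemma semidecidable_uniformization:
  fixes G :: "'a::encodable \<Rightarrow> 'b::enumerable \<Rightarrow> bool"
  assumes "semidecidable (\<lambda>z. G (fst z) (snd z))"
  obtains p where "\<And>x y. G x y \<Longrightarrow> \<exists>y'. G x y' \<and> eval p (enc x) (enc y')"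
    and "\<And>x. halts p (enc x) \<Longrightarrow> \<exists>y. G x y"
proof -
  from assms obtain R where R: "computable R" "\<And>z. G (fst z) (snd z) \<longleftrightarrow> (\<exists>t::nat. R (z, t))"
    unfolding semidecidable_def by blast
  obtain d where d: "computable d" "surj (d :: nat \<Rightarrow> 'b)" using ex_computable_surj by blast
  let ?R = "\<lambda>z. R ((fst z, d (fst (prod_decode (snd z)))), snd (prod_decode (snd z)))"
  have "computable ?R"
    by (intro comp_intros computable_comp[OF R(1)] computable_comp[OF d(1)])
  then obtain p where p: "\<And>x n. eval p (enc x) n \<longleftrightarrow> ?R (x, n) \<and> (\<forall>k<n. \<not> ?R (x, k))"
    by (rule least_search_prog) blast
  have "computable (\<lambda>n. d (fst (prod_decode n)))"
    by (intro comp_intros computable_comp[OF d(1)])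
  then obtain q where "\<And>n. eval q (enc n) (enc (d (fst (prod_decode n))))"
    unfolding computable_def by blast
  hence q: "\<And>n. eval q n (enc (d (fst (prod_decode n))))" by simp
  have G: "?R (x, n) \<Longrightarrow> G x (d (fst (prod_decode n)))" for x n
    using R(2)[of "(x, _)"] by auto
  show thesis
  proof (rule that[of "Comp q p"])
    fix x y
    assume "G x y"
    then obtain t where "R ((x, y), t)" using R(2)[of "(x, y)"] by auto
    moreover obtain k where "y = d k" using d(2) by blast
    ultimately have "?R (x, prod_encode (k, t))" by simp
    then obtain n where n: "?R (x, n)" "\<forall>k<n. \<not> ?R (x, k)"
      using exists_least_iff[of "\<lambda>n. ?R (x, n)"] by blast
    with p q have "eval (Comp q p) (enc x) (enc (d (fst (prod_decode n))))"
      by (blast intro: eval_Comp)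
    with G[OF n(1)] show "\<exists>y'. G x y' \<and> eval (Comp q p) (enc x) (enc y')" by blast
  next
    fix x :: 'a
    assume "halts (Comp q p) (enc x)"
    then obtain n where "eval p (enc x) n"
      unfolding halts_def by (auto elim: eval.cases)
    with p G show "\<exists>y. G x y" by blast
  qed
qed

text \<open>For a total relation the search always ends. This supplies the extension step of the
  Baire construction.\<close>

lemma computable_selector:
  fixes G :: "'a::encodable \<Rightarrow> 'b::enumerable \<Rightarrow> bool"
  assumes "semidecidable (\<lambda>z. G (fst z) (snd z))" "\<And>x. \<exists>y. G x y"
  obtains h where "computable h" "\<And>x. G x (h x)"
proof -
  from assms(1) obtain p where p: "\<And>x y. G x y \<Longrightarrow> \<exists>y'. G x y' \<and> eval p (enc x) (enc y')"
    by (rule semidecidable_uniformization) blast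
  with assms(2) have "\<forall>x. \<exists>y. G x y \<and> eval p (enc x) (enc y)" by blast
  then obtain h where "\<forall>x. G x (h x) \<and> eval p (enc x) (enc (h x))" by metis
  with that show thesis unfolding computable_def by blast
qed

lemma semidecidable_halts:
  fixes P :: "'a::encodable \<Rightarrow> bool"
  assumes "semidecidable P"
  obtains p where "\<And>x. halts p (enc x) \<longleftrightarrow> P x"
proof -
  have "semidecidable (\<lambda>z :: 'a \<times> nat. P (fst z))"
    by (intro semidecidable_comp[OF assms] comp_intros)
  then obtain p where "\<And>x (y::nat). P x \<Longrightarrow> \<exists>y' :: nat. P x \<and> eval p (enc x) (enc y')"
    "\<And>x. halts p (enc x) \<Longrightarrow> \<exists>y :: nat. P x"
    by (rule semidecidable_uniformization) blast
  with that show thesis unfolding halts_def by blast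
qed

text \<open>A rule \<open>R L x\<close> reads: \<open>x\<close> follows in one step from the members of \<open>L\<close>.\<close>

inductive derivable :: "('a list \<Rightarrow> 'a \<Rightarrow> bool) \<Rightarrow> 'a \<Rightarrow> bool" for R where
  "(\<And>y. y \<in> set L \<Longrightarrow> derivable R y) \<Longrightarrow> R L x \<Longrightarrow> derivable R x"

text \<open>Derivations are written backwards, with the last conclusion at the head, so that the
  lines available to an entry form the suffix behind it.\<close>

primrec derivation :: "('a list \<Rightarrow> 'a \<Rightarrow> bool) \<Rightarrow> 'a list \<Rightarrow> bool" where
  "derivation R [] \<longleftrightarrow> True"
| "derivation R (x # L) \<longleftrightarrow> R L x \<and> derivation R L"

text \<open>Replaces the recursion by a bounded quantifier over suffixes, a shape to which the
  closure rules for semidecidable predicates apply.\<close>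

lemma derivation_iff_drop:
  "derivation R L \<longleftrightarrow> (\<forall>i<length L. \<exists>y ys. drop i L = y # ys \<and> R ys y)"
  by (induction L) (auto simp: All_less_Suc2)

lemma derivation_sound: "derivation R L \<Longrightarrow> x \<in> set L \<Longrightarrow> derivable R x"
proof (induction L arbitrary: x)
  case (Cons y L)
  hence "derivable R z" if "z \<in> set L" for z
    using that by simp
  with Cons.prems show ?case
    using derivable.intros[of L R y] by auto
qed simp

lemma derivation_append:
  assumes mono: "\<And>L L' x. R L x \<Longrightarrow> set L \<subseteq> set L' \<Longrightarrow> R L' x"
  shows "derivation R L \<Longrightarrow> derivation R L' \<Longrightarrow> derivation R (L @ L')"
proof (induction L)
  case (Cons x L)
  thus ?case using mono[of L x "L @ L'"] by simp
qed simp

lemma derivation_complete: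
  assumes mono: "\<And>L L' x. R L x \<Longrightarrow> set L \<subseteq> set L' \<Longrightarrow> R L' x"
  assumes "derivable R x"
  shows "\<exists>L. derivation R L \<and> x \<in> set L"
  using assms(2)
proof induction
  case (1 L x)
  \<comment> \<open>The derivations of the premises are concatenated one by one. By
    \<open>mono\<close> the entries stay valid in front of a longer list.\<close>
  have "\<exists>C. derivation R C \<and> set K \<subseteq> set C" if "set K \<subseteq> set L" for K
    using that
  proof (induction K)
    case Nil
    show ?case by (rule exI[of _ "[]"]) simp
  next
    case (Cons y K)
    then obtain C where C: "derivation R C" "set K \<subseteq> set C" by auto
    from Cons.prems 1 obtain D where D: "derivation R D" "y \<in> set D"
      by (meson list.set_intros(1) subsetD)
    from C D show ?case
      using derivation_append[OF mono C(1) D(1)] by (intro exI[of _ "C @ D"]) auto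
  qed
  then obtain C where "derivation R C" "set L \<subseteq> set C" by blast
  with mono[OF \<open>R L x\<close>] have "derivation R (x # C)" by simp
  thus ?case by (meson list.set_intros(1))
qed

text \<open>A search for a finite derivation, whose correctness is a bounded conjunction of
  semidecidable steps. Evaluation and machine output both fall under this scheme.\<close>

lemma semidecidable_derivable:
  fixes R :: "'a::enumerable list \<Rightarrow> 'a \<Rightarrow> bool"
  assumes "semidecidable (\<lambda>z. R (fst z) (snd z))"
    and mono: "\<And>L L' x. R L x \<Longrightarrow> set L \<subseteq> set L' \<Longrightarrow> R L' x"
  shows "semidecidable (derivable R)"
proof -
  have R: "semidecidable (\<lambda>z. R (f z) (g z))" if "computable f" "computable g" for f g
    using semidecidable_comp[OF assms(1), of "\<lambda>z. (f z, g z)"] that by (simp add: comp_intros)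
  have complete: "\<exists>L. derivation R L \<and> x \<in> set L" if "derivable R x" for x
    using that by (rule derivation_complete[rotated]) (rule mono)
  have "derivable R = (\<lambda>x. \<exists>L. (\<forall>i<length L. \<exists>y ys. drop i L = y # ys \<and> R ys y) \<and> x \<in> set L)"
    unfolding derivation_iff_drop[symmetric]
    by (rule ext) (blast intro: derivation_sound complete)
  moreover have "semidecidable (\<lambda>x. \<exists>L. (\<forall>i<length L. \<exists>y ys. drop i L = y # ys \<and> R ys y) \<and> x \<in> set L)"
    by (intro sd_intros R comp_intros; intro semidecidable_computable comp_intros)
  ultimately show ?thesis by simp
qed

section \<open>Semidecidability of evaluation\<close>

text \<open>The clauses of \<open>eval\<close> with \<open>e\<close> a plain number, so that the
  program becomes part of the argument. Numbers that are no index do no harm, because facts are read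
  back only at \<open>index f\<close>.\<close>

definition eval_rule :: "(nat \<times> nat \<times> nat) list \<Rightarrow> nat \<times> nat \<times> nat \<Rightarrow> bool" where
  "eval_rule L z \<longleftrightarrow> (\<exists>e n m. z = (e, n, m) \<and>
     (e = index Zero \<and> m = 0 \<or>
      e = index Succ \<and> m = Suc n \<or>
      e = index Fst \<and> m = fst (prod_decode n) \<or>
      e = index Snd \<and> m = snd (prod_decode n) \<or>
      (\<exists>f g a b. e = prod_encode (4, prod_encode (f, g)) \<and> m = prod_encode (a, b) \<and>
         (f, n, a) \<in> set L \<and> (g, n, b) \<in> set L) \<or>
      (\<exists>f g k. e = prod_encode (5, prod_encode (f, g)) \<and>
         (g, n, k) \<in> set L \<and> (f, k, m) \<in> set L) \<or>
      (\<exists>f g a. e = prod_encode (6, prod_encode (f, g)) \<and> n = prod_encode (a, 0) \<and>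
         (f, a, m) \<in> set L) \<or>
      (\<exists>f g a k r. e = prod_encode (6, prod_encode (f, g)) \<and> n = prod_encode (a, Suc k) \<and>
         (e, prod_encode (a, k), r) \<in> set L \<and>
         (g, prod_encode (a, prod_encode (k, r)), m) \<in> set L) \<or>
      (\<exists>f. e = prod_encode (7, f) \<and> (f, prod_encode (n, m), 0) \<in> set L \<and>
         (\<forall>k<m. \<exists>r. (f, prod_encode (n, k), Suc r) \<in> set L))))"

lemma eval_rule_mono:
  assumes "eval_rule L z" "set L \<subseteq> set L'" shows "eval_rule L' z"
proof -
  have "z \<in> set L \<longrightarrow> z \<in> set L'" for z
    using assms(2) by blast
  hence "eval_rule L z \<longrightarrow> eval_rule L' z"
    unfolding eval_rule_def
    by (intro ex_mono all_mono disj_mono conj_mono imp_mono) (assumption | rule imp_refl)+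
  with assms(1) show ?thesis by blast
qed

lemma semidecidable_eval_rule: "semidecidable (\<lambda>z. eval_rule (fst z) (snd z))"
  unfolding eval_rule_def
  by (intro sd_intros comp_intros; intro semidecidable_computable comp_intros)

lemma eval_of_derivable:
  assumes "derivable eval_rule z" "z = (index f, n, m)"
  shows "eval f n m"
  using assms
proof (induction arbitrary: f n m)
  case (1 L z)
  have IH: "eval f n m" if "(index f, n, m) \<in> set L" for f n m
    using 1 that by blast
  have R: "eval_rule L (index f, n, m)"
    using 1 by simp
  show ?case
  proof (cases f)
    case Fst
    obtain a b where "n = prod_encode (a, b)" by (metis prod_decode_inverse surj_pair)
    with R Fst show ?thesis by (auto simp: eval_rule_def intro: eval_Fst)
  next
    case Snd
    obtain a b where "n = prod_encode (a, b)" by (metis prod_decode_inverse surj_pair)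
    with R Snd show ?thesis by (auto simp: eval_rule_def intro: eval_Snd)
  next
    case (Prec g h)
    from R[unfolded eval_rule_def] Prec IH[of g] IH[of h] IH[of f] show ?thesis
      by auto (blast intro: eval_Prec_0 eval_Prec_Suc)+
  next
    case (Mu g)
    with R have "(index g, prod_encode (n, m), 0) \<in> set L"
      "\<forall>k<m. \<exists>r. (index g, prod_encode (n, k), Suc r) \<in> set L"
      by (auto simp: eval_rule_def)
    with IH[of g] Mu show ?thesis by (blast intro: eval_Mu)
  qed (use R IH in \<open>auto simp: eval_rule_def intro: eval.intros\<close>)
qed

lemma derivable_of_eval: "eval f n m \<Longrightarrow> derivable eval_rule (index f, n, m)"
proof (induction rule: eval.induct)
  case (eval_Pair f n a g b)
  show ?case
    by (rule derivable.intros[of "[(index f, n, a), (index g, n, b)]"]) (use eval_Pair in \<open>auto simp: eval_rule_def\<close>)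
next
  case (eval_Comp g n m f k)
  show ?case
    by (rule derivable.intros[of "[(index g, n, m), (index f, m, k)]"]) (use eval_Comp in \<open>auto simp: eval_rule_def\<close>)
next
  case (eval_Prec_0 f a m g)
  show ?case
    by (rule derivable.intros[of "[(index f, a, m)]"]) (use eval_Prec_0 in \<open>auto simp: eval_rule_def\<close>)
next
  case (eval_Prec_Suc f g a n m k)
  show ?case
    by (rule derivable.intros[of "[(index (Prec f g), prod_encode (a, n), m),
        (index g, prod_encode (a, prod_encode (n, m)), k)]"]) (use eval_Prec_Suc in \<open>auto simp: eval_rule_def\<close>)
next
  case (eval_Mu f a n)
  then obtain r where r: "\<forall>k<n. derivable eval_rule (index f, prod_encode (a, k), Suc (r k))"
    by metis
  let ?L = "(index f, prod_encode (a, n), 0) #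
    map (\<lambda>k. (index f, prod_encode (a, k), Suc (r k))) [0..<n]"
  show ?case
  proof (rule derivable.intros[of ?L])
    show "derivable eval_rule y" if "y \<in> set ?L" for y
      using that eval_Mu.IH r by auto
    have "\<exists>r. (index f, prod_encode (a, k), Suc r) \<in> set ?L" if "k < n" for k
      using that by (intro exI[of _ "r k"]) auto
    thus "eval_rule ?L (index (Mu f), a, n)"
      by (simp add: eval_rule_def)
  qed
qed (rule derivable.intros[of "[]"], simp, simp add: eval_rule_def)+

lemma derivable_eval_rule_iff: "derivable eval_rule (index f, n, m) \<longleftrightarrow> eval f n m"
  using eval_of_derivable derivable_of_eval by blast

text \<open>With the index inside the argument, one semidecision serves all programs uniformly, as
  working from a Markov name requires.\<close>

lemma semidecidable_derivable_eval_rule: "semidecidable (derivable eval_rule)"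
  by (rule semidecidable_derivable[OF semidecidable_eval_rule]) (rule eval_rule_mono)

lemma semidecidable_eval:
  assumes "computable a" "computable b" shows "semidecidable (\<lambda>x. eval f (a x) (b x))"
  unfolding derivable_eval_rule_iff[symmetric]
  by (intro semidecidable_comp[OF semidecidable_derivable_eval_rule] comp_intros assms)

section \<open>Monotone machines\<close>

text \<open>The evaluation of \<open>M\<close> is a side condition and not a derived fact. It is
  only semidecidable, which is all that \<open>semidecidable_derivable\<close> asks of a
  rule.\<close>

definition outputs_rule ::
  "prog \<Rightarrow> (bool list \<times> bool list) list \<Rightarrow> bool list \<times> bool list \<Rightarrow> bool" where
  "outputs_rule M L z \<longleftrightarrow> z = ([], []) \<or>
     (\<exists>p v b. z = (p, v @ [b]) \<and> (p, v) \<in> set L \<and> eval M (enc (p, v)) (of_bool b)) \<or>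
     (\<exists>p v b. z = (p @ [b], v) \<and> (p, v) \<in> set L \<and> eval M (enc (p, v)) 2)"

lemma semidecidable_outputs_rule: "semidecidable (\<lambda>z. outputs_rule M (fst z) (snd z))"
  unfolding outputs_rule_def
  by (intro sd_intros comp_intros semidecidable_eval; intro semidecidable_computable comp_intros)

lemma outputs_rule_mono:
  assumes "outputs_rule M L z" "set L \<subseteq> set L'" shows "outputs_rule M L' z"
proof -
  have "z \<in> set L \<longrightarrow> z \<in> set L'" for z
    using assms(2) by blast
  hence "outputs_rule M L z \<longrightarrow> outputs_rule M L' z"
    unfolding outputs_rule_def
    by (intro ex_mono disj_mono conj_mono) (assumption | rule imp_refl)+
  with assms(1) show ?thesis by blast
qed

lemma outputs_iff_derivable: "outputs M p v \<longleftrightarrow> derivable (outputs_rule M) (p, v)"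
proof
  assume "outputs M p v"
  thus "derivable (outputs_rule M) (p, v)"
  proof induction
    case outputs_start
    show ?case by (rule derivable.intros[of "[]"]) (auto simp: outputs_rule_def)
  next
    case (outputs_write p v b)
    show ?case
      by (rule derivable.intros[of "[(p, v)]"]) (use outputs_write in \<open>auto simp: outputs_rule_def enc_bool_list\<close>)
  next
    case (outputs_read p v b)
    show ?case
      by (rule derivable.intros[of "[(p, v)]"]) (use outputs_read in \<open>auto simp: outputs_rule_def enc_bool_list\<close>)
  qed
next
  assume "derivable (outputs_rule M) (p, v)"
  hence "outputs M (fst z) (snd z)" if "z = (p, v)" for z
    using that
  proof (induction "(p, v)" arbitrary: p v z)
    case (1 L)
    have IH: "outputs M p v" if "(p, v) \<in> set L" for p v
      using 1 that by force
    from 1(3) show ?case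
      unfolding outputs_rule_def 1(4)
      by (auto simp: enc_bool_list intro: outputs.intros IH)
  qed
  thus "outputs M p v" by simp
qed

lemma semidecidable_outputs:
  assumes "computable a" "computable b" shows "semidecidable (\<lambda>x. outputs M (a x) (b x))"
proof -
  have "semidecidable (derivable (outputs_rule M))"
    by (rule semidecidable_derivable[OF semidecidable_outputs_rule]) (rule outputs_rule_mono)
  thus ?thesis
    unfolding outputs_iff_derivable by (rule semidecidable_comp) (intro comp_intros assms)
qed

text \<open>The sum of the two lengths counts tape operations. Since \<open>eval\<close> is
  deterministic, runs part only at a bit that is read; configurations with comparable inputs thus
  lie on one run, ordered by that count.\<close>

lemma outputs_linear:
  assumes "outputs M p v" "outputs M p' v'" "length p + length v \<le> length p' + length v'"
    and "prefix p p' \<or> prefix p' p"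
  shows "prefix p p' \<and> prefix v v'"
  using assms
proof (induction "length p' + length v'" arbitrary: p v p' v')
  case 0
  thus ?case by simp
next
  case (Suc k)
  have step: "\<exists>q w a. outputs M q w \<and> length q + length w = k \<and> prefix q r \<and> prefix w u \<and>
      eval M (prod_encode (string_index q, string_index w)) a \<and>
      ((\<exists>b. a = of_bool b \<and> r = q \<and> u = w @ [b]) \<or> (\<exists>b. a = 2 \<and> r = q @ [b] \<and> u = w))"
    if "outputs M r u" "length r + length u = Suc k" for r u
    using that by cases fastforce+
  obtain q w a where qw: "outputs M q w" "length q + length w = k" "prefix q p'" "prefix w v'"
    and a: "eval M (prod_encode (string_index q, string_index w)) a"
      "(\<exists>b. a = of_bool b \<and> p' = q \<and> v' = w @ [b]) \<or> (\<exists>b. a = 2 \<and> p' = q @ [b] \<and> v' = w)"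
    using step[OF Suc(4)] Suc(2) by auto
  have comp: "prefix p q \<or> prefix q p"
    using Suc(6) qw(3) prefix_same_cases prefix_order.trans by metis
  show ?case
  proof (cases "length p + length v \<le> k")
    case True
    with Suc(1)[of q w p v] Suc(3) qw comp have "prefix p q" "prefix v w" by auto
    with qw show ?thesis by (meson prefix_order.trans)
  next
    case False
    hence len: "length p + length v = Suc k" using Suc by simp
    obtain r u a' where ru: "outputs M r u" "length r + length u = k" "prefix r p" "prefix u v"
      and a': "eval M (prod_encode (string_index r, string_index u)) a'"
        "(\<exists>b. a' = of_bool b \<and> p = r \<and> v = u @ [b]) \<or> (\<exists>b. a' = 2 \<and> p = r @ [b] \<and> v = u)"
      using step[OF Suc(3) len] by auto
    have rq: "prefix r q \<or> prefix q r"
      using comp qw(3) ru(3) prefix_same_cases prefix_order.trans by metis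
    \<comment> \<open>Both predecessors have count \<open>k\<close>, so the induction hypothesis
      applies in both directions and identifies them. Then the last operations agree too; a bit read
      there is the same because the inputs are comparable.\<close>
    have "prefix r q \<and> prefix u w" "prefix q r \<and> prefix w u"
      using Suc(1)[of q w r u] Suc(1)[of r u q w] qw ru rq by auto
    hence eq: "r = q" "u = w" by (auto intro: prefix_order.antisym)
    with a(1) a'(1) have "a = a'" by (auto dest: eval_deterministic)
    with a(2) a'(2) eq Suc(6) show ?thesis
      by (auto simp: of_bool_def split: if_splits)
  qed
qed

lemma prefix_same_length: "prefix u w \<Longrightarrow> prefix u' w \<Longrightarrow> length u = length u' \<Longrightarrow> u = u'"
  by (auto simp: prefix_def)

text \<open>Both outputs lie on the run on \<open>p\<close>. It follows that shortest programs are
  distinct for distinct strings of one length.\<close>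

lemma output_extends_unique:
  assumes "output_extends M p u" "output_extends M p u'" "length u = length u'"
  shows "u = u'"
proof -
  from assms obtain v v' where v: "outputs M p v" "prefix u v" "outputs M p v'" "prefix u' v'"
    unfolding output_extends_def by blast
  have "prefix v v' \<or> prefix v' v"
    using outputs_linear[OF v(1,3)] outputs_linear[OF v(3,1)]
    by (cases "length v \<le> length v'") simp_all
  then obtain w where "prefix u w" "prefix u' w"
    using prefix_order.trans[OF v(2)] prefix_order.trans[OF v(4)] v(2,4) by blast
  with assms(3) show ?thesis by (blast intro: prefix_same_length)
qed

section \<open>Initial segments and cylinders\<close>

lemma init_seg_Suc: "init_seg x (Suc n) = init_seg x n @ [x n]"
  by (simp add: init_seg_def)

lemma length_init_seg [simp]: "length (init_seg x n) = n"
  by (simp add: init_seg_def)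

lemma init_seg_eq_iff: "init_seg x n = u \<longleftrightarrow> length u = n \<and> (\<forall>i<n. u ! i = x i)"
  by (auto simp: init_seg_def list_eq_iff_nth_eq)

lemma prefix_init_seg:
  assumes "m \<le> n" shows "prefix (init_seg x m) (init_seg x n)"
proof -
  obtain k where "n = m + k" using assms le_Suc_ex by blast
  hence "init_seg x n = init_seg x m @ map x [m..<m + k]"
    using upt_add_eq_append[of 0 m k] by (simp add: init_seg_def)
  thus ?thesis by (simp add: prefix_def)
qed

lemma mem_cylinder_iff_prefix: "length u \<le> n \<Longrightarrow> x \<in> cylinder u \<longleftrightarrow> prefix u (init_seg x n)"
  using prefix_init_seg[of "length u" n x]
  by (auto simp: cylinder_def intro: prefix_same_length)

text \<open>The machine reads \<open>1\<^sup>m0\<close> and then writes the sequence number \<open>m\<close> of the family.\<close>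

lemma optimal_machine_bound:
  fixes G :: "nat \<Rightarrow> nat \<Rightarrow> bool \<Rightarrow> bool"
  assumes U: "optimal_monotone_machine U"
    and G: "semidecidable (\<lambda>z. G (fst z) (fst (snd z)) (snd (snd z)))"
  shows "\<exists>d. \<forall>m x n. (\<forall>k b. G m k b \<longleftrightarrow> b = x k) \<longrightarrow>
    (\<exists>q. output_extends U q (init_seg x n) \<and> length q \<le> m + d)"
proof -
  \<comment> \<open>A relation between configurations and operations. Uniformization may pick any
    related operation, so \<open>H\<close> is shown below to allow only one in each configuration
    that matters.\<close>
  define H where "H z r \<longleftrightarrow> fst z = replicate (length (fst z)) True \<and> r = 2 \<or>
      (\<exists>m b. fst z = replicate m True @ [False] \<and> G m (length (snd z)) b \<and> r = of_bool b)"
    for z :: "bool list \<times> bool list" and r :: nat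
  have G': "semidecidable (\<lambda>z. G (f z) (g z) (h z))"
    if "computable f" "computable g" "computable h" for f g and h :: "'z::encodable \<Rightarrow> bool"
    using semidecidable_comp[OF G, of "\<lambda>z. (f z, g z, h z)"] that by (simp add: comp_intros)
  have "semidecidable (\<lambda>z. H (fst z) (snd z))"
    unfolding H_def
    by (intro sd_intros comp_intros G'; intro semidecidable_computable comp_intros)
  then obtain M where M: "\<And>z r. H z r \<Longrightarrow> \<exists>r'. H z r' \<and> eval M (enc z) (enc r')"
    by (rule semidecidable_uniformization) blast
  have neq: "replicate k True \<noteq> replicate m True @ [False]" for k m
  proof
    assume "replicate k True = replicate m True @ [False]"
    from arg_cong[OF this, of "\<lambda>u. False \<in> set u"] show False by simp
  qed
  have read: "eval M (prod_encode (string_index (replicate k True), string_index v)) 2" for k v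
  proof -
    have "H (replicate k True, v) r \<longleftrightarrow> r = 2" for r
      unfolding H_def by (simp add: neq)
    with M[of "(replicate k True, v)" 2] show ?thesis
      by (simp add: enc_bool_list)
  qed
  have ones: "outputs M (replicate k True) []" for k
  proof (induction k)
    case (Suc k)
    have "replicate (Suc k) True = replicate k True @ [True]"
      by (simp add: replicate_append_same)
    with outputs_read[OF Suc read, of True] show ?case by simp
  qed (simp add: outputs_start)
  obtain d where d: "\<And>p u. output_extends M p u \<Longrightarrow>
      \<exists>q. output_extends U q u \<and> length q \<le> length p + d"
    using U unfolding optimal_monotone_machine_def by blast
  have out: "outputs M (replicate m True @ [False]) (init_seg x n)"
    if x: "\<And>k b. G m k b \<longleftrightarrow> b = x k" for m x n
  proof (induction n)
    case 0
    show ?case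
      using outputs_read[OF ones read] by (simp add: init_seg_def)
  next
    case (Suc n)
    let ?p = "replicate m True @ [False]"
    have "H (?p, init_seg x n) r \<longleftrightarrow> r = of_bool (x n)" for r
      unfolding H_def using neq[of "Suc m" m, THEN not_sym] by (simp add: x)
    with M[of "(?p, init_seg x n)" "of_bool (x n)"]
    have "eval M (prod_encode (string_index ?p, string_index (init_seg x n))) (of_bool (x n))"
      by (simp add: enc_bool_list)
    thus ?case
      unfolding init_seg_Suc by (rule outputs_write[OF Suc])
  qed
  \<comment> \<open>The successor pays for the 0 that ends the unary code of
    \<open>m\<close>.\<close>
  show ?thesis
  proof (rule exI[of _ "Suc d"], intro allI impI)
    fix m x n
    assume "\<forall>k b. G m k b \<longleftrightarrow> b = x k"
    hence "output_extends M (replicate m True @ [False]) (init_seg x n)"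
      unfolding output_extends_def using out[of m x n] by blast
    from d[OF this] show "\<exists>q. output_extends U q (init_seg x n) \<and> length q \<le> m + Suc d"
      by simp
  qed
qed

section \<open>Shortest programs and the counting of simple strings\<close>

lemma computable_seqs_eq: "computable_seqs = {x. computable x}"
  by (simp add: computable_seqs_def computes_def computable_def)

definition pad :: "bool list \<Rightarrow> nat \<Rightarrow> bool" where
  "pad u n \<longleftrightarrow> n < length u \<and> u ! n"

lemma init_seg_pad [simp]: "init_seg (pad u) (length u) = u"
  by (simp add: init_seg_eq_iff pad_def)

lemma computable_pad: "computable (pad u)"
proof -
  have "finite {n. pad u n}"
    by (rule finite_subset[of _ "{..<length u}"]) (auto simp: pad_def)
  from computable_finite_set[OF this] show ?thesis by simp
qed

lemma Km_le: "output_extends U q u \<Longrightarrow> length q \<le> k \<Longrightarrow> Km U u \<le> k"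
  unfolding Km_def by (rule order_trans[OF Least_le]) blast

text \<open>Optimality, applied to the constant family of \<open>u\<close> followed by zeros, yields
  some program for \<open>u\<close>. Hence the \<open>LEAST\<close> in \<open>Km\<close> is a
  genuine minimum.\<close>

lemma Km_attained:
  assumes "optimal_monotone_machine U"
  shows "\<exists>p. output_extends U p u \<and> length p = Km U u"
proof -
  have "computable (\<lambda>z :: nat \<times> nat \<times> bool. snd (snd z) = pad u (fst (snd z)))"
    by (intro comp_intros computable_comp[OF computable_pad])
  hence "semidecidable (\<lambda>z :: nat \<times> nat \<times> bool. snd (snd z) = pad u (fst (snd z)))"
    by (rule semidecidable_computable)
  from optimal_machine_bound[OF assms, of "\<lambda>m k b. b = pad u k", OF this]
  have "\<exists>q. output_extends U q (init_seg (pad u) (length u))" by blast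
  hence "\<exists>k p. output_extends U p u \<and> length p = k" by simp
  thus ?thesis unfolding Km_def by (rule LeastI_ex)
qed

text \<open>Upper bounds on \<open>Km\<close> are Sigma_1, since a short program can be searched
  for.\<close>

lemma Km_less_iff:
  assumes "optimal_monotone_machine U"
  shows "2 * Km U u < k \<longleftrightarrow> (\<exists>p v. outputs U p v \<and> prefix u v \<and> 2 * length p < k)"
proof
  assume "2 * Km U u < k"
  with Km_attained[OF assms, of u] show "\<exists>p v. outputs U p v \<and> prefix u v \<and> 2 * length p < k"
    unfolding output_extends_def by metis
next
  assume "\<exists>p v. outputs U p v \<and> prefix u v \<and> 2 * length p < k"
  then obtain p where "output_extends U p u" "2 * length p < k"
    unfolding output_extends_def by blast
  with Km_le[of U p u, OF _ order_refl] show "2 * Km U u < k" by fastforce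
qed

lemma card_bool_lists_less:
  "finite {p :: bool list. length p < k} \<and> card {p :: bool list. length p < k} < 2 ^ k"
proof (induction k)
  case (Suc k)
  have eq: "{p :: bool list. length p < Suc k} = {p. length p < k} \<union> {p. length p = k}"
    by auto
  have "finite {p :: bool list. length p = k}" "card {p :: bool list. length p = k} = 2 ^ k"
    using finite_lists_length_eq[of "UNIV :: bool set" k] card_lists_length_eq[of "UNIV :: bool set" k]
    by simp_all
  moreover have "card ({p :: bool list. length p < k} \<union> {p. length p = k})
      \<le> card {p :: bool list. length p < k} + card {p :: bool list. length p = k}"
    by (rule card_Un_le)
  ultimately show ?case using Suc unfolding eq by simp
qed simp

text \<open>Shortest programs map these strings injectively into the strings shorter than
  \<open>k\<close>.\<close>

lemma card_simple_strings:
  assumes "optimal_monotone_machine U"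
  shows "finite {u. length u = n \<and> Km U u < k}" "card {u. length u = n \<and> Km U u < k} < 2 ^ k"
proof -
  obtain f where f: "\<And>u. output_extends U (f u) u \<and> length (f u) = Km U u"
    using Km_attained[OF assms] by metis
  have inj: "inj_on f {u. length u = n \<and> Km U u < k}"
    by (rule inj_onI) (metis (mono_tags, lifting) f mem_Collect_eq output_extends_unique)
  have sub: "f ` {u. length u = n \<and> Km U u < k} \<subseteq> {p. length p < k}"
    using f by auto
  show "finite {u. length u = n \<and> Km U u < k}"
    using inj sub card_bool_lists_less[of k] by (blast intro: inj_on_finite)
  show "card {u. length u = n \<and> Km U u < k} < 2 ^ k"
    using card_inj_on_le[OF inj sub] card_bool_lists_less[of k] by simp
qed

lemma ex_complex_extension:
  assumes "optimal_monotone_machine U"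
  obtains x n where "computable x" "x \<in> cylinder w" "n + 2 * c \<le> 2 * Km U (init_seg x n)"
proof -
  \<comment> \<open>Chosen so that \<open>2 * k = n + 2 * c\<close>: an extension of
    \<open>w\<close> by \<open>k\<close> bits with complexity at least \<open>k\<close> breaks the
    bound at its own length \<open>n\<close>.\<close>
  define k where "k = length w + 2 * c"
  define n where "n = length w + k"
  define E where "E = append w ` {s. length s = k}"
  have "card {s :: bool list. length s = k} = 2 ^ k"
    using card_lists_length_eq[of "UNIV :: bool set" k] by simp
  hence "card E = 2 ^ k"
    unfolding E_def by (subst card_image) (auto simp: inj_on_def)
  moreover have "card E \<le> card {u. length u = n \<and> Km U u < k}"
    if "E \<subseteq> {u. length u = n \<and> Km U u < k}"
    by (rule card_mono[OF card_simple_strings(1)[OF assms] that])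
  ultimately have "\<not> E \<subseteq> {u. length u = n \<and> Km U u < k}"
    using card_simple_strings(2)[OF assms, of n k] by auto
  then obtain s where s: "length s = k" "\<not> Km U (w @ s) < k"
    unfolding E_def n_def by auto
  have len: "n = length (w @ s)" by (simp add: n_def s)
  show thesis
  proof (rule that[of "pad (w @ s)" n])
    show "computable (pad (w @ s))" by (rule computable_pad)
    show "pad (w @ s) \<in> cylinder w"
      by (subst mem_cylinder_iff_prefix[of _ n]) (simp_all add: len del: length_append, simp)
    show "n + 2 * c \<le> 2 * Km U (init_seg (pad (w @ s)) n)"
      using s unfolding len init_seg_pad by (simp add: k_def)
  qed
qed

section \<open>Topology of Cantor space\<close>

lemma open_cylinder: "open (cylinder u)"
proof -
  have "cylinder u = (\<Inter>i<length u. (\<lambda>x. x i) -` {u ! i})"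
    by (auto simp: cylinder_def init_seg_eq_iff)
  also have "open \<dots>"
    by (intro open_INT ballI open_vimage continuous_on_product_coordinates open_discrete) auto
  finally show ?thesis .
qed

lemma closed_init_seg: "closed {x. P (init_seg x n)}"
proof -
  have "- {x. P (init_seg x n)} = (\<Union>u\<in>{u. length u = n \<and> \<not> P u}. cylinder u)"
    by (auto simp: cylinder_def)
  thus ?thesis
    unfolding closed_def by (auto intro: open_cylinder)
qed

text \<open>A basic open set restricts finitely many coordinates, all of them below some
  \<open>n\<close>.\<close>

lemma open_contains_cylinder:
  assumes "open O'" "x \<in> O'"
  obtains n where "cylinder (init_seg x n) \<subseteq> O'"
proof -
  have "openin (product_topology (\<lambda>i. euclidean) UNIV) O'"
    using assms(1) unfolding open_fun_def .
  from product_topology_open_contains_basis[OF this assms(2)]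
  obtain X where X: "x \<in> Pi\<^sub>E UNIV X" "finite {i. X i \<noteq> UNIV}" "Pi\<^sub>E UNIV X \<subseteq> O'"
    unfolding topspace_euclidean by (elim exE conjE) (rule that)
  obtain n where n: "{i. X i \<noteq> UNIV} \<subseteq> {..<n}"
    using finite_nat_bounded[OF X(2)] by blast
  have "cylinder (init_seg x n) \<subseteq> Pi\<^sub>E UNIV X"
  proof
    fix y assume "y \<in> cylinder (init_seg x n)"
    hence y: "\<forall>i<n. y i = x i"
      by (simp add: cylinder_def init_seg_def)
    have "y i \<in> X i" for i
    proof (cases "i < n")
      case True
      with y X(1) show ?thesis by (simp add: PiE_iff)
    next
      case False
      hence "i \<notin> {i. X i \<noteq> UNIV}" using n by auto
      thus ?thesis by simp
    qed
    thus "y \<in> Pi\<^sub>E UNIV X" by (simp add: PiE_iff)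
  qed
  with X(3) have "cylinder (init_seg x n) \<subseteq> O'" by (rule order_trans[rotated])
  thus thesis by (rule that)
qed

section \<open>Sequences of low monotone complexity\<close>

text \<open>The bound \<open>n / 2 + c\<close> is doubled to stay within the natural
  numbers.\<close>

definition low_seqs :: "prog \<Rightarrow> nat \<Rightarrow> (nat \<Rightarrow> bool) set" where
  "low_seqs U c = {x \<in> computable_seqs. \<forall>n. 2 * Km U (init_seg x n) < n + 2 * c}"

text \<open>A comparison bit by bit: with a semidecidable graph in place of \<open>b = x i\<close>,
  the right-hand side becomes a semidecidable condition on \<open>u\<close>.\<close>

lemma init_seg_eq_drop_iff:
  "u = init_seg x n \<longleftrightarrow> length u = n \<and> (\<forall>i<n. \<exists>b s. drop i u = b # s \<and> b = x i)"
proof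
  assume u: "u = init_seg x n"
  have "drop i u = x i # drop (Suc i) u" if "i < n" for i
    using that Cons_nth_drop_Suc[of i u] by (simp add: u init_seg_def)
  with u show "length u = n \<and> (\<forall>i<n. \<exists>b s. drop i u = b # s \<and> b = x i)" by simp
next
  assume u: "length u = n \<and> (\<forall>i<n. \<exists>b s. drop i u = b # s \<and> b = x i)"
  have "u ! i = x i" if "i < n" for i
    using u that Cons_nth_drop_Suc[of i u] by fastforce
  with u have "init_seg x n = u" by (simp add: init_seg_eq_iff)
  thus "u = init_seg x n" by simp
qed

lemma markov_semidecidable_low_seqs:
  assumes U: "optimal_monotone_machine U"
  shows "markov_semidecidable (low_seqs U c)"
proof -
  define G where "G e i b \<longleftrightarrow> derivable eval_rule (e, i, of_bool b)" for e i b
  have G: "semidecidable (\<lambda>z. G (f z) (g z) (h z))"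
    if "computable f" "computable g" "computable h" for f g and h :: "'z::encodable \<Rightarrow> bool"
    unfolding G_def
    by (intro semidecidable_comp[OF semidecidable_derivable_eval_rule] comp_intros that)
  have "semidecidable (\<lambda>z. G (fst z) (fst (snd z)) (snd (snd z)))"
    by (intro G comp_intros)
  from optimal_machine_bound[OF U this] obtain d where
    d: "\<forall>m x n. (\<forall>k b. G m k b \<longleftrightarrow> b = x k) \<longrightarrow>
      (\<exists>q. output_extends U q (init_seg x n) \<and> length q \<le> m + d)"
    by (elim exE)
  \<comment> \<open>Only the graph \<open>G e\<close> is available in place of \<open>x\<close>; at
    a name of \<open>x\<close> the two agree. The range includes \<open>n = 2 * (e + d)\<close>;
    beyond it \<open>2 * Km \<le> 2 * (e + d) < n\<close>, whatever \<open>c\<close> is.\<close>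
  define P where "P e \<longleftrightarrow> (\<forall>n<Suc (2 * (e + d)). \<exists>u p v s.
      (length u = n \<and> (\<forall>i<n. \<exists>b s. drop i u = b # s \<and> G e i b)) \<and>
      outputs U p v \<and> v = u @ s \<and> 2 * length p < n + 2 * c)" for e
  have "semidecidable P"
    unfolding P_def[abs_def]
    by (intro sd_intros comp_intros G semidecidable_outputs;
        intro semidecidable_computable comp_intros)
  then obtain p where p: "\<And>e. halts p (enc e) \<longleftrightarrow> P e"
    by (rule semidecidable_halts) blast
  have "halts p e \<longleftrightarrow> x \<in> low_seqs U c" if "markov_name e x" "x \<in> computable_seqs" for e x
  proof -
    from that(1) obtain f where f: "e = index f" "\<And>n. eval f n (of_bool (x n))"
      unfolding markov_name_def computes_def by blast
    have Ge: "G e i b \<longleftrightarrow> b = x i" for i b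
      unfolding G_def f(1) derivable_eval_rule_iff
      using f(2)[of i] eval_deterministic[OF f(2)[of i], of "of_bool b"] of_bool_eq_iff by metis
    have P_iff: "P e \<longleftrightarrow> (\<forall>n<Suc (2 * (e + d)). 2 * Km U (init_seg x n) < n + 2 * c)"
      unfolding P_def Ge init_seg_eq_drop_iff[symmetric] Km_less_iff[OF U] prefix_def by simp
    have le: "Km U (init_seg x n) \<le> e + d" for n
    proof -
      obtain q where "output_extends U q (init_seg x n)" "length q \<le> e + d"
        using spec[OF spec[OF spec[OF d, of e], of x], of n] Ge by blast
      thus ?thesis by (rule Km_le)
    qed
    have "2 * Km U (init_seg x n) < n + 2 * c" if "\<not> n < Suc (2 * (e + d))" for n
      using that le[of n] by presburger
    with P_iff have "P e \<longleftrightarrow> (\<forall>n. 2 * Km U (init_seg x n) < n + 2 * c)"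
      by blast
    thus ?thesis using p[of e] that(2) by (simp add: low_seqs_def)
  qed
  thus ?thesis
    unfolding markov_semidecidable_def by (auto simp: low_seqs_def)
qed

lemma Km_zero_seq_bounded:
  assumes U: "optimal_monotone_machine U"
  obtains d where "\<And>n. Km U (init_seg (\<lambda>_. False) n) \<le> d"
proof -
  have "semidecidable (\<lambda>z :: nat \<times> nat \<times> bool. \<not> snd (snd z))"
    by (intro semidecidable_computable comp_intros)
  from optimal_machine_bound[OF U, of "\<lambda>_ _ b. \<not> b", OF this] obtain d where
    d: "\<forall>m x n. (\<forall>(k::nat) b. (\<not> b) \<longleftrightarrow> b = x k) \<longrightarrow>
      (\<exists>q. output_extends U q (init_seg x n) \<and> length q \<le> m + d)"
    by (elim exE)
  have "\<exists>q. output_extends U q (init_seg (\<lambda>_. False) n) \<and> length q \<le> 0 + d" for n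
    using spec[OF spec[OF spec[OF d, of 0], of "\<lambda>_. False"], of n] by simp
  hence "Km U (init_seg (\<lambda>_. False) n) \<le> d" for n
    by (metis Km_le add_0)
  thus thesis by (rule that)
qed

lemma closedin_low_seqs: "closedin (top_of_set computable_seqs) (low_seqs U c)"
proof -
  have "low_seqs U c = computable_seqs \<inter>
      (\<Inter>n. {x. 2 * Km U (init_seg x n) < length (init_seg x n) + 2 * c})"
    by (auto simp: low_seqs_def)
  moreover have "closed (\<Inter>n. {x. 2 * Km U (init_seg x n) < length (init_seg x n) + 2 * c})"
    by (intro closed_INT ballI closed_init_seg)
  ultimately show ?thesis
    by (auto simp: closedin_closed)
qed

lemma interior_low_seqs_empty:
  assumes "optimal_monotone_machine U"
  shows "(top_of_set computable_seqs) interior_of (low_seqs U c) = {}"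
proof (rule ccontr)
  assume "(top_of_set computable_seqs) interior_of (low_seqs U c) \<noteq> {}"
  then obtain x T where T: "openin (top_of_set computable_seqs) T" "x \<in> T" "T \<subseteq> low_seqs U c"
    unfolding interior_of_def by blast
  from T(1) obtain T' where T': "open T'" "T = computable_seqs \<inter> T'"
    unfolding openin_open by blast
  with T(2) obtain n where n: "cylinder (init_seg x n) \<subseteq> T'"
    by (metis IntD2 open_contains_cylinder)
  obtain y k where y: "computable y" "y \<in> cylinder (init_seg x n)"
    "k + 2 * c \<le> 2 * Km U (init_seg y k)"
    using ex_complex_extension[OF assms] by metis
  hence "y \<in> T" using n T'(2) by (auto simp: computable_seqs_eq)
  with T(3) y(3) show False by (auto simp: low_seqs_def not_less[symmetric])
qed

section \<open>Diagonalisation against Sigma^0_2 sets\<close>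

lemma uniformly_effective_open_semidecidable:
  assumes "uniformly_effective_open V"
  obtains P where "semidecidable (\<lambda>z. P (fst z) (snd z))"
    "\<And>n. V n = (\<Union>u\<in>{u. P n u}. cylinder u)"
proof -
  from assms obtain f where f: "\<And>n. V n = \<Union> {cylinder u | u. halts f (prod_encode (n, string_index u))}"
    unfolding uniformly_effective_open_def ce_def by auto
  define P where "P n u \<longleftrightarrow> (\<exists>m. eval f (enc (n, u)) m)" for n :: nat and u :: "bool list"
  have "semidecidable (\<lambda>z. P (fst z) (snd z))"
    unfolding P_def by (intro sd_intros semidecidable_eval comp_intros)
  moreover have "V n = (\<Union>u\<in>{u. P n u}. cylinder u)" for n
    unfolding f P_def halts_def by (auto simp: enc_bool_list)
  ultimately show thesis by (rule that)
qed

lemma not_sigma02_low_seqs: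
  assumes U: "optimal_monotone_machine U"
    and c: "\<And>n. Km U (init_seg (\<lambda>_. False) n) < c"
    and S: "sigma02 S"
  shows "S \<inter> computable_seqs \<noteq> low_seqs U c"
proof
  assume SA: "S \<inter> computable_seqs = low_seqs U c"
  obtain V W where V: "uniformly_effective_open V" and W: "uniformly_effective_open W"
    and SVW: "S = (\<Union>n. V n - W n)"
    using S unfolding sigma02_def by blast
  obtain P where P: "semidecidable (\<lambda>z. P (fst z) (snd z))"
    and VP: "\<And>n. V n = (\<Union>u\<in>{u. P n u}. cylinder u)"
    using uniformly_effective_open_semidecidable[OF V] by blast
  obtain Q where Q: "semidecidable (\<lambda>z. Q (fst z) (snd z))"
    and WQ: "\<And>n. W n = (\<Union>u\<in>{u. Q n u}. cylinder u)"
    using uniformly_effective_open_semidecidable[OF W] by blast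
  have Q': "semidecidable (\<lambda>z. Q (f z) (g z))" if "computable f" "computable g"
    for f and g :: "'z::encodable \<Rightarrow> bool list"
    using semidecidable_comp[OF Q, of "\<lambda>z. (f z, g z)"] that by (simp add: comp_intros)
  \<comment> \<open>The extension step needs the negation of \<open>P n u\<close>, which need not be
    semidecidable. With a time bound \<open>t\<close> it becomes decidable, and \<open>D\<close>
    runs through all requirements \<open>(n, u, t)\<close>.\<close>
  obtain R where R: "computable R" and PR: "\<And>n u. P n u \<longleftrightarrow> (\<exists>t::nat. R ((n, u), t))"
    using P unfolding semidecidable_def by fastforce
  obtain D :: "nat \<Rightarrow> nat \<times> bool list \<times> nat" where D: "computable D" "surj D"
    using ex_computable_surj by blast
  \<comment> \<open>\<open>F (k, w) w'\<close>: \<open>w'\<close> properly extends \<open>w\<close>, and \<open>[w']\<close> misses \<open>[u] - W n\<close> unless \<open>(n, u)\<close> has not been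
    accepted by time \<open>t\<close>, where \<open>D k = (n, u, t)\<close>.\<close>
  define F where "F z w' \<longleftrightarrow> (\<exists>s. w' = snd z @ s \<and> s \<noteq> []) \<and>
     (\<not> R ((fst (D (fst z)), fst (snd (D (fst z)))), snd (snd (D (fst z)))) \<or>
      (\<exists>a b r s. fst (snd (D (fst z))) = a @ b # r \<and> w' = a @ (\<not> b) # s) \<or>
      (\<exists>v s. w' = v @ s \<and> Q (fst (D (fst z))) v))" for z :: "nat \<times> bool list" and w'
  have "semidecidable (\<lambda>z. F (fst z) (snd z))"
    unfolding F_def
    by (intro sd_intros Q' comp_intros computable_comp[OF D(1)];
        intro semidecidable_computable comp_intros computable_comp[OF D(1)] computable_comp[OF R])
  \<comment> \<open>This is density. A complex computable \<open>y\<close> in \<open>[w]\<close>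
    lies outside \<open>S\<close>, so if it is in \<open>[u]\<close> and thereby in
    \<open>V n\<close>, it is in \<open>W n\<close>. A long initial segment of \<open>y\<close>
    witnesses whichever alternative holds.\<close>
  moreover have "\<exists>w'. F z w'" for z
  proof -
    obtain k w where z: "z = (k, w)" by (cases z)
    obtain n u t where Dk: "D k = (n, u, t)" by (cases "D k")
    obtain y j where y: "computable y" "y \<in> cylinder w" "j + 2 * c \<le> 2 * Km U (init_seg y j)"
      using ex_complex_extension[OF U] by metis
    have ext: "\<exists>s. init_seg y N = w @ s \<and> s \<noteq> []" if "length w < N" for N
    proof -
      from that y(2) obtain s where s: "init_seg y N = w @ s"
        using mem_cylinder_iff_prefix[of w N y] by (auto simp: prefix_def)
      with that arg_cong[OF s, of length] show ?thesis by auto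
    qed
    have yS: "y \<notin> S"
    proof
      assume "y \<in> S"
      with y(1) SA have "y \<in> low_seqs U c" by (auto simp: computable_seqs_eq)
      with y(3) show False by (auto simp: low_seqs_def not_less[symmetric])
    qed
    consider "\<not> R ((n, u), t)" | "y \<notin> cylinder u" | "R ((n, u), t)" "y \<in> cylinder u" by blast
    thus ?thesis
    proof cases
      case 1
      with ext[of "Suc (length w)"] have "F z (init_seg y (Suc (length w)))"
        by (simp add: F_def z Dk)
      thus ?thesis by blast
    next
      case 2
      \<comment> \<open>Longer than \<open>u\<close>, so that leaving \<open>[u]\<close> shows as a
        disagreement at a bit of \<open>u\<close>; longer than \<open>w\<close>, so that the
        extension is proper.\<close>
      let ?N = "Suc (length w + length u)"
      have "\<not> prefix u (init_seg y ?N)"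
        using 2 mem_cylinder_iff_prefix[of u ?N y] by simp
      moreover have "\<not> prefix (init_seg y ?N) u"
        by (auto dest: prefix_length_le)
      ultimately have "u \<parallel> init_seg y ?N" by (simp add: parallel_def)
      from parallel_decomp[OF this] obtain a b b' r s
        where ab: "b \<noteq> b'" "u = a @ b # r" "init_seg y ?N = a @ b' # s"
        by (elim exE conjE)
      hence "b' = (\<not> b)" by simp
      with ab(2,3) have "\<exists>a b r s. u = a @ b # r \<and> init_seg y ?N = a @ (\<not> b) # s" by fast
      with ext[of ?N] have "F z (init_seg y ?N)"
        by (simp add: F_def z Dk)
      thus ?thesis by blast
    next
      case 3
      hence "y \<in> V n" unfolding VP using PR by blast
      with yS SVW have "y \<in> W n" by blast
      then obtain v where v: "Q n v" "y \<in> cylinder v" unfolding WQ by blast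
      let ?N = "Suc (length w + length v)"
      have "\<exists>s. init_seg y ?N = v @ s"
        using v(2) mem_cylinder_iff_prefix[of v ?N y] by (simp add: prefix_def)
      with v(1) have "\<exists>v s. init_seg y ?N = v @ s \<and> Q n v" by fast
      with ext[of ?N] have "F z (init_seg y ?N)"
        by (simp add: F_def z Dk)
      thus ?thesis by blast
    qed
  qed
  ultimately obtain h where h: "computable h" "\<And>z. F z (h z)"
    by (rule computable_selector) blast
  \<comment> \<open>Stage \<open>k\<close> treats requirement \<open>D k\<close>. The recursion is
    uniform in \<open>m\<close>, so one machine and one overhead \<open>d\<close> serve the whole
    family, and choosing \<open>m = d\<close> afterwards is not circular.\<close>
  define w where "w m k = rec_nat (replicate (4 * m) False) (\<lambda>k r. h (k, r)) k" for m k :: nat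
  \<comment> \<open>Here \<open>pad\<close> only reads a bit. Its default is never reached, because
    \<open>w m (Suc n)\<close> has length at least \<open>n + 1\<close>.\<close>
  define x where "x m n \<longleftrightarrow> pad (w m (Suc n)) n" for m n
  have w_Suc: "\<exists>s. w m (Suc k) = w m k @ s \<and> s \<noteq> []" for m k
    using h(2)[of "(k, w m k)"] by (simp add: F_def w_def)
  have w_length: "k \<le> length (w m k)" for m k
  proof (induction k)
    case (Suc k)
    obtain b s where "w m (Suc k) = w m k @ b # s"
      using w_Suc[of m k] by (metis list.exhaust)
    with Suc show ?case by simp
  qed simp
  have w_prefix: "prefix (w m j) (w m k)" if "j \<le> k" for m j k
    using that
  proof (induction k rule: dec_induct)
    case (step k)
    with w_Suc[of m k] show ?case by (auto intro: prefix_order.trans)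
  qed simp
  have w_x: "init_seg (x m) (length (w m k)) = w m k" for m k
  proof -
    have "w m k ! i = x m i" if "i < length (w m k)" for i
    proof -
      have "prefix (w m k) (w m (Suc i)) \<or> prefix (w m (Suc i)) (w m k)"
        using w_prefix by (meson nle_le)
      moreover have "i < length (w m (Suc i))" using w_length[of "Suc i" m] by simp
      ultimately have "w m k ! i = w m (Suc i) ! i"
        using that by (auto simp: prefix_def nth_append)
      with \<open>i < length (w m (Suc i))\<close> show ?thesis by (simp add: x_def pad_def)
    qed
    thus ?thesis by (simp add: init_seg_eq_iff)
  qed
  have pad_nth: "pad u n \<longleftrightarrow> (case drop n u of [] \<Rightarrow> False | b # _ \<Rightarrow> b)" for u n
    by (cases "n < length u") (auto simp: pad_def simp flip: Cons_nth_drop_Suc)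
  have x_comp: "computable (\<lambda>z. x (f z) (g z))" if "computable f" "computable g"
    for f and g :: "'z::encodable \<Rightarrow> nat"
    unfolding x_def pad_nth w_def
    by (intro comp_intros computable_comp[OF h(1)] that)
  have "semidecidable (\<lambda>z. snd (snd z) = x (fst z) (fst (snd z)))"
    by (intro semidecidable_computable comp_intros x_comp)
  from optimal_machine_bound[OF U, of "\<lambda>m k b. b = x m k", OF this] obtain d where
    d: "\<forall>m y n. (\<forall>k b. b = x m k \<longleftrightarrow> b = y k) \<longrightarrow>
      (\<exists>q. output_extends U q (init_seg y n) \<and> length q \<le> m + d)"
    by (elim exE)
  have Km_x: "Km U (init_seg (x d) n) \<le> d + d" for n
  proof -
    obtain q where "output_extends U q (init_seg (x d) n)" "length q \<le> d + d"
      using spec[OF spec[OF spec[OF d, of d], of "x d"], of n] by blast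
    thus ?thesis by (rule Km_le)
  qed
  \<comment> \<open>Up to \<open>4 * d\<close> the sequence is zero and hypothesis \<open>c\<close>
    applies; beyond that \<open>2 * Km \<le> 4 * d < n\<close>.\<close>
  have "2 * Km U (init_seg (x d) n) < n + 2 * c" for n
  proof (cases "n \<le> 4 * d")
    case True
    have "w d 0 = replicate (4 * d) False" by (simp add: w_def)
    with w_x[of d 0] have "\<forall>i<4 * d. \<not> x d i" by (auto simp: init_seg_eq_iff)
    hence "init_seg (x d) n = init_seg (\<lambda>_. False) n"
      using True by (simp add: init_seg_def)
    with c[of n] show ?thesis by simp
  next
    case False
    with Km_x[of n] show ?thesis by simp
  qed
  moreover have "computable (\<lambda>n. x d n)"
    by (intro x_comp comp_intros)
  ultimately have "x d \<in> low_seqs U c"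
    by (simp add: low_seqs_def computable_seqs_eq)
  hence "x d \<in> S" using SA by blast
  then obtain n where "x d \<in> V n" and xW: "x d \<notin> W n" unfolding SVW by blast
  then obtain u t where u: "x d \<in> cylinder u" "R ((n, u), t)" unfolding VP using PR by blast
  \<comment> \<open>The stage that treated \<open>(n, u, t)\<close>. As \<open>R\<close> holds
    there, \<open>w d (Suc k)\<close> has left \<open>[u]\<close> or entered \<open>W n\<close>, and
    either contradicts the choice of \<open>n\<close> and \<open>u\<close>.\<close>
  obtain k where k: "D k = (n, u, t)" using surjD[OF D(2), of "(n, u, t)"] by metis
  have x_prefix: "prefix v (w d (Suc k)) \<Longrightarrow> x d \<in> cylinder v" for v
    using mem_cylinder_iff_prefix[OF prefix_length_le, of v "init_seg (x d) (length (w d (Suc k)))" "x d"]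
    by (simp add: w_x)
  have "F (k, w d k) (w d (Suc k))"
    using h(2) by (simp add: w_def)
  with k u(2) have "(\<exists>a b r s. u = a @ b # r \<and> w d (Suc k) = a @ (\<not> b) # s) \<or>
      (\<exists>v s. w d (Suc k) = v @ s \<and> Q n v)"
    by (simp add: F_def)
  then consider a b r s where "u = a @ b # r" "w d (Suc k) = a @ (\<not> b) # s"
    | v s where "w d (Suc k) = v @ s" "Q n v"
    by blast
  thus False
  proof cases
    case 1
    hence "x d \<in> cylinder (a @ [\<not> b])" by (intro x_prefix) simp
    moreover have "prefix (a @ [b]) (init_seg (x d) (length u))"
      using u(1) 1(1) by (simp add: cylinder_def)
    hence "x d \<in> cylinder (a @ [b])"
      using mem_cylinder_iff_prefix[of "a @ [b]" "length u" "x d"] 1(1) by simp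
    ultimately show False by (simp add: cylinder_def)
  next
    case 2
    hence "x d \<in> W n" unfolding WQ using x_prefix[of v] by auto
    with xW show False by contradiction
  qed
qed

lemma less_half_add_iff: "real k < real n / 2 + real c \<longleftrightarrow> 2 * k < n + 2 * c"
  by linarith

theorem mainTheorem10:
  fixes U :: prog
  assumes "optimal_monotone_machine U"
  shows "\<exists>c0::nat. \<forall>c\<ge>c0.
    (let A = {x \<in> computable_seqs.
                \<forall>n. real (Km U (init_seg x n)) < real n / 2 + real c}
     in markov_semidecidable A \<and>
        A \<noteq> {} \<and>
        closedin (top_of_set computable_seqs) A \<and>
        (top_of_set computable_seqs) interior_of A = {} \<and>
        \<not> (\<exists>S. sigma02 S \<and> S \<inter> computable_seqs = A))"
proof -
  obtain d where d: "\<And>n. Km U (init_seg (\<lambda>_. False) n) \<le> d"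
    using Km_zero_seq_bounded[OF assms] by blast
  \<comment> \<open>The threshold puts all initial segments of the zero sequence strictly below
    \<open>c\<close>. This gives non-emptiness and also covers the initial block of zeros in the
    diagonalisation.\<close>
  show ?thesis
  proof (intro exI[of _ "Suc d"] allI impI)
    fix c assume c: "Suc d \<le> c"
    have zero: "Km U (init_seg (\<lambda>_. False) n) < c" for n
      using d[of n] c by simp
    have "(\<lambda>_. False) \<in> low_seqs U c"
      using zero by (auto simp: low_seqs_def computable_seqs_eq computable_const intro: trans_less_add2)
    hence "low_seqs U c \<noteq> {}" by blast
    with markov_semidecidable_low_seqs[OF assms, of c] closedin_low_seqs[of U c]
      interior_low_seqs_empty[OF assms, of c] not_sigma02_low_seqs[OF assms zero]
    show "let A = {x \<in> computable_seqs.
                \<forall>n. real (Km U (init_seg x n)) < real n / 2 + real c}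
     in markov_semidecidable A \<and>
        A \<noteq> {} \<and>
        closedin (top_of_set computable_seqs) A \<and>
        (top_of_set computable_seqs) interior_of A = {} \<and>
        \<not> (\<exists>S. sigma02 S \<and> S \<inter> computable_seqs = A)"
      unfolding Let_def less_half_add_iff low_seqs_def by blast
  qed
qed

end
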